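(* Under the standing assumptions below, consider the unrestricted subspace sampling model and the class $\mathcal{A}^{\rm res}$. If the integration problem is strongly polynomially tractable for $\mathcal{A}^{\rm res}$, then $\mathrm{decay}_{\gamma,\sigma}>1$ for all $\sigma\in\mathbb{N}$. Moreover, if $\mathrm{decay}_{\gamma,\sigma}>1$ for all $\sigma\in\mathbb{N}$, then $$p^{\rm res}_{\rm unr}\ge\max\Big\{\frac{2}{\alpha},\ \sup_{\sigma\in\mathbb{N}}\frac{2\min\{1,s/t^*_\sigma\}}{\mathrm{decay}_{\gamma,\sigma}-1}\Big\},$$ where a term with $\mathrm{decay}_{\gamma,\sigma}=\infty$ is interpreted as $0$ (and $s/0=\infty$).
   Context: Setting: $\mathcal{U}$ = finite subsets of $\mathbb{N}$; $D\subseteq\mathbb{R}$ Borel; $k$ a nonzero measurable reproducing kernel on $D\times D$ with anchor $a\in D$ ($k(a,a)=0$); $\rho$ a probability measure on $D$ with $M=\int k(x,x)\rho(dx)<\infty$; $k_u(\mathbf{x},\mathbf{y})=\prod_{j\in u}k(x_j,y_j)$, $k_\emptyset\equiv1$, RKHS $H_u$; weights $\gamma=(\gamma_u)_{u\in\mathcal{U}}\ge0$ with $\sum_u\gamma_uM^{|u|}<\infty$; $\mathcal{X}=\{\mathbf{x}\in D^{\mathbb{N}}:\sum_u\gamma_uk_u(\mathbf{x},\mathbf{x})<\infty\}$; $\mathcal{H}_\gamma$ the RKHS of $K_\gamma=\sum_u\gamma_uk_u$ on $\mathcal{X}$, unit ball $B_\gamma$; $I(f)=\int_{\mathcal{X}}f\,d\rho^{\mathbb{N}}$.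 Let $C_0=\int\int k\,d\rho\,d\rho>0$, $\widehat\gamma_u=\gamma_uC_0^{|u|}$. Algorithms access $f$ only through values $f(\mathbf{x})$, $\mathbf{x}\in D^{\mathbb{N}}$ ($f:=0$ off $\mathcal{X}$). Weights notions: for $\sigma\in\mathbb{N}\cup\{\infty\}$, cut-off weights $\gamma^{(\sigma)}_u=\gamma_u$ if $|u|\le\sigma$, else $0$; $u_1(\sigma),u_2(\sigma),\dots$ are the distinct nonempty $u$ with $\gamma^{(\sigma)}_u>0$, ordered so that $\widehat\gamma_{u_1(\sigma)}\ge\widehat\gamma_{u_2(\sigma)}\ge\cdots$. $\mathrm{decay}_{\gamma,\sigma}=\sup\{p\in\mathbb{R}:\lim_{j\to\infty}\widehat\gamma_{u_j(\sigma)}j^p=0\}$. $t^*_\sigma=\inf\{t\ge0:\exists C_t>0\ \forall v\in\mathcal{U}:|\{i:u_i(\sigma)\subseteq v\}|\le C_t|v|^t\}$. Cost and algorithms: fix nondecreasing $\$:\mathbb{N}_0\to[1,\infty]$; $\mathcal{X}_{v,a}=\{\mathbf{x}\in D^{\mathbb{N}}:x_j=a\ \forall j\notin v\}$. Unrestricted cost function $c_a(\mathbf{x})=\inf\{\$(|u|):u\in\mathcal{U},\mathbf{x}\in\mathcal{X}_{u,a}\}$. A randomized algorithm $Q:\Omega\times\mathcal{H}_\gamma\to\mathbb{R}$ yields square-integrable $Q(f)$ from function values; $\mathrm{cost}_{c_a}(Q,f)$ is the sum of $c_a$ over its evaluation points, and $\mathrm{cost}_{\rm unr}(Q,F)=\sup_{f\in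 F}\mathbb{E}(\mathrm{cost}_{c_a}(Q,f))$. $Q\in\mathcal{A}^{\rm res}$ if there are $n\in\mathbb{N}_0$ and $v_1,\dots,v_n\in\mathcal{U}$ such that for every $f$, $Q$ performs exactly $n$ evaluations, the $i$th point lying in $\mathcal{X}_{v_i,a}$, and $\mathbb{E}(\mathrm{cost}_{c_a}(Q,f))=\sum_{i=1}^n\$(|v_i|)$. Error $e(Q,F)=(\sup_{f\in F}\mathbb{E}[(I(f)-Q(f))^2])^{1/2}$. $\mathrm{comp}^{\rm res}_{\rm unr}(\varepsilon)=\inf\{\mathrm{cost}_{\rm unr}(Q,B_\gamma):Q\in\mathcal{A}^{\rm res},e(Q,B_\gamma)\le\varepsilon\}$; strong polynomial tractability means $\mathrm{comp}\le C\varepsilon^{-p}$ for all $\varepsilon>0$ for some $C,p\ge0$, and $p^{\rm res}_{\rm unr}$ is the infimum of such $p$. Standing assumptions: $\$(\nu)=\Omega(\nu^s)$ for some $s\in(0,\infty)$; $\gamma_{\{1\}}>0$; and there is $\alpha>0$ such that the $N$th minimal randomized error for univariate integration $\int_Dg\,d\rho$ over the unit ball of $H(\gamma_{\{1\}}k)$ (infimum of randomized worst-case errors of randomized algorithms with expected cost at most $N$, each evaluation costing $\$(1)$) is $\Omega(N^{-\alpha/2})$. *)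

theory Defs
  imports "HOL-Probability.Probability"
begin

definition psd_kernel :: "('x \<Rightarrow> 'x \<Rightarrow> real) \<Rightarrow> 'x set \<Rightarrow> bool" where
  "psd_kernel K X \<longleftrightarrow>
     (\<forall>x\<in>X. \<forall>y\<in>X. K x y = K y x) \<and>
     (\<forall>(n::nat) (xs::nat \<Rightarrow> 'x) (c::nat \<Rightarrow> real). (\<forall>i<n. xs i \<in> X) \<longrightarrow>
        0 \<le> (\<Sum>i<n. \<Sum>j<n. c i * c j * K (xs i) (xs j)))"

definition is_rkhs ::
  "('x \<Rightarrow> 'x \<Rightarrow> real) \<Rightarrow> 'x set \<Rightarrow> ('x \<Rightarrow> real) set
     \<Rightarrow> (('x \<Rightarrow> real) \<Rightarrow> ('x \<Rightarrow> real) \<Rightarrow> real) \<Rightarrow> bool" where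
  "is_rkhs K X F ip \<longleftrightarrow>
     (\<forall>f\<in>F. \<forall>x. x \<notin> X \<longrightarrow> f x = 0) \<and>
     (\<lambda>x. 0) \<in> F \<and>
     (\<forall>f\<in>F. \<forall>g\<in>F. (\<lambda>x. f x + g x) \<in> F) \<and>
     (\<forall>c. \<forall>f\<in>F. (\<lambda>x. c * f x) \<in> F) \<and>
     (\<forall>f\<in>F. \<forall>g\<in>F. ip f g = ip g f) \<and>
     (\<forall>f\<in>F. \<forall>g\<in>F. \<forall>h\<in>F. ip (\<lambda>x. f x + g x) h = ip f h + ip g h) \<and>
     (\<forall>c. \<forall>f\<in>F. \<forall>g\<in>F. ip (\<lambda>x. c * f x) g = c * ip f g) \<and>
     (\<forall>f\<in>F. 0 \<le> ip f f \<and> (ip f f = 0 \<longrightarrow> f = (\<lambda>x. 0))) \<and>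
     (\<forall>S::nat \<Rightarrow> ('x \<Rightarrow> real). (\<forall>n. S n \<in> F) \<and>
          (\<forall>e>0. \<exists>N. \<forall>m\<ge>N. \<forall>n\<ge>N.
              ip (\<lambda>x. S m x - S n x) (\<lambda>x. S m x - S n x) < e)
        \<longrightarrow> (\<exists>g\<in>F. (\<lambda>n. ip (\<lambda>x. S n x - g x) (\<lambda>x. S n x - g x)) \<longlonglongrightarrow> 0)) \<and>
     (\<forall>y\<in>X. (\<lambda>x. if x \<in> X then K x y else 0) \<in> F \<and>
        (\<forall>f\<in>F. ip f (\<lambda>x. if x \<in> X then K x y else 0) = f y))"

definition unit_ball :: "('x \<Rightarrow> real) set \<Rightarrow> (('x \<Rightarrow> real) \<Rightarrow> ('x \<Rightarrow> real) \<Rightarrow> real)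
    \<Rightarrow> ('x \<Rightarrow> real) set" where
  "unit_ball F ip = {f \<in> F. ip f f \<le> 1}"

definition ku :: "(real \<Rightarrow> real \<Rightarrow> real) \<Rightarrow> nat set \<Rightarrow> (nat \<Rightarrow> real) \<Rightarrow> (nat \<Rightarrow> real) \<Rightarrow> real" where
  "ku k u x y = (\<Prod>j\<in>u. k (x j) (y j))"

definition Xdom :: "(real \<Rightarrow> real \<Rightarrow> real) \<Rightarrow> (nat set \<Rightarrow> real) \<Rightarrow> real set \<Rightarrow> (nat \<Rightarrow> real) set" where
  "Xdom k \<gamma> D = {x. (\<forall>j. x j \<in> D) \<and> (\<lambda>u. \<gamma> u * ku k u x x) summable_on {u. finite u}}"

definition Kgam :: "(real \<Rightarrow> real \<Rightarrow> real) \<Rightarrow> (nat set \<Rightarrow> real) \<Rightarrow> (nat \<Rightarrow> real) \<Rightarrow> (nat \<Rightarrow> real) \<Rightarrow> real" where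
  "Kgam k \<gamma> x y = (\<Sum>\<^sub>\<infinity>u\<in>{u. finite u}. \<gamma> u * ku k u x y)"

definition Mk :: "(real \<Rightarrow> real \<Rightarrow> real) \<Rightarrow> real measure \<Rightarrow> real" where
  "Mk k \<rho> = (\<integral>x. k x x \<partial>\<rho>)"

definition C0 :: "(real \<Rightarrow> real \<Rightarrow> real) \<Rightarrow> real measure \<Rightarrow> real" where
  "C0 k \<rho> = (\<integral>y. (\<integral>x. k x y \<partial>\<rho>) \<partial>\<rho>)"

text \<open>Integration functional I(f) w.r.t. the infinite product measure (f = 0 off X).\<close>
definition Iint :: "real measure \<Rightarrow> ((nat \<Rightarrow> real) \<Rightarrow> real) \<Rightarrow> real" where
  "Iint \<rho> f = (\<integral>x. f x \<partial>(PiM UNIV (\<lambda>_. \<rho>)))"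

definition Xva :: "real set \<Rightarrow> real \<Rightarrow> nat set \<Rightarrow> (nat \<Rightarrow> real) set" where
  "Xva D a v = {x. (\<forall>j. x j \<in> D) \<and> (\<forall>j. j \<notin> v \<longrightarrow> x j = a)}"

definition cost_a :: "(nat \<Rightarrow> ennreal) \<Rightarrow> real set \<Rightarrow> real \<Rightarrow> (nat \<Rightarrow> real) \<Rightarrow> ennreal" where
  "cost_a cst D a x = (INF u \<in> {u. finite u \<and> x \<in> Xva D a u}. cst (card u))"

text \<open>A randomized algorithm: probability space, adaptive choice of the i-th point from
  omega and the previously observed values, adaptive stopping rule, and output map.\<close>
record ('w, 'x) ralg =
  ra_space :: "'w measure"
  ra_pt    :: "nat \<Rightarrow> 'w \<Rightarrow> real list \<Rightarrow> 'x"
  ra_stop  :: "'w \<Rightarrow> real list \<Rightarrow> bool"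
  ra_res   :: "'w \<Rightarrow> real list \<Rightarrow> real"

fun ra_vals :: "('w, 'x) ralg \<Rightarrow> ('x \<Rightarrow> real) \<Rightarrow> 'w \<Rightarrow> nat \<Rightarrow> real list" where
  "ra_vals A f \<omega> 0 = []"
| "ra_vals A f \<omega> (Suc i) =
     ra_vals A f \<omega> i @ [f (ra_pt A i \<omega> (ra_vals A f \<omega> i))]"

definition ra_point :: "('w, 'x) ralg \<Rightarrow> ('x \<Rightarrow> real) \<Rightarrow> 'w \<Rightarrow> nat \<Rightarrow> 'x" where
  "ra_point A f \<omega> i = ra_pt A i \<omega> (ra_vals A f \<omega> i)"

definition ra_card :: "('w, 'x) ralg \<Rightarrow> ('x \<Rightarrow> real) \<Rightarrow> 'w \<Rightarrow> enat" where
  "ra_card A f \<omega> = (if \<exists>i. ra_stop A \<omega> (ra_vals A f \<omega> i)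
      then enat (LEAST i. ra_stop A \<omega> (ra_vals A f \<omega> i)) else \<infinity>)"

definition ra_out :: "('w, 'x) ralg \<Rightarrow> ('x \<Rightarrow> real) \<Rightarrow> 'w \<Rightarrow> real" where
  "ra_out A f \<omega> = ra_res A \<omega> (ra_vals A f \<omega> (LEAST i. ra_stop A \<omega> (ra_vals A f \<omega> i)))"

definition ra_cost :: "('x \<Rightarrow> ennreal) \<Rightarrow> ('w, 'x) ralg \<Rightarrow> ('x \<Rightarrow> real) \<Rightarrow> 'w \<Rightarrow> ennreal" where
  "ra_cost c A f \<omega> = (\<Sum>i. if enat i < ra_card A f \<omega> then c (ra_point A f \<omega> i) else 0)"

definition ra_exp_cost :: "('x \<Rightarrow> ennreal) \<Rightarrow> ('w, 'x) ralg \<Rightarrow> ('x \<Rightarrow> real) \<Rightarrow> ennreal" where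
  "ra_exp_cost c A f = (\<integral>\<^sup>+ \<omega>. ra_cost c A f \<omega> \<partial>ra_space A)"

definition cost_unr :: "('x \<Rightarrow> ennreal) \<Rightarrow> ('w, 'x) ralg \<Rightarrow> ('x \<Rightarrow> real) set \<Rightarrow> ennreal" where
  "cost_unr c A B = (SUP f \<in> B. ra_exp_cost c A f)"

definition ra_valid :: "('w, 'x) ralg \<Rightarrow> ('x \<Rightarrow> real) set \<Rightarrow> bool" where
  "ra_valid A F \<longleftrightarrow> prob_space (ra_space A) \<and>
     (\<forall>f\<in>F. ra_out A f \<in> borel_measurable (ra_space A) \<and>
            integrable (ra_space A) (\<lambda>\<omega>. (ra_out A f \<omega>)\<^sup>2))"

definition wce2 :: "('w, 'x) ralg \<Rightarrow> (('x \<Rightarrow> real) \<Rightarrow> real) \<Rightarrow> ('x \<Rightarrow> real) set \<Rightarrow> ennreal" where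
  "wce2 A I B = (SUP f \<in> B. \<integral>\<^sup>+ \<omega>. ennreal ((I f - ra_out A f \<omega>)\<^sup>2) \<partial>ra_space A)"

definition in_Ares :: "(nat \<Rightarrow> ennreal) \<Rightarrow> real set \<Rightarrow> real \<Rightarrow> ((nat \<Rightarrow> real) \<Rightarrow> real) set
    \<Rightarrow> ('w, nat \<Rightarrow> real) ralg \<Rightarrow> bool" where
  "in_Ares cst D a F A \<longleftrightarrow> ra_valid A F \<and>
     (\<exists>(n::nat) (v::nat \<Rightarrow> nat set). (\<forall>i<n. finite (v i)) \<and>
        (\<forall>f\<in>F. \<forall>\<omega>\<in>space (ra_space A). ra_card A f \<omega> = enat n \<and>
            (\<forall>i<n. ra_point A f \<omega> i \<in> Xva D a (v i))) \<and>
        (\<forall>f\<in>F. ra_exp_cost (cost_a cst D a) A f = (\<Sum>i<n. cst (card (v i)))))"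

definition comp_res :: "'w itself \<Rightarrow> (nat \<Rightarrow> ennreal) \<Rightarrow> real set \<Rightarrow> real
    \<Rightarrow> ((nat \<Rightarrow> real) \<Rightarrow> real) set \<Rightarrow> ((nat \<Rightarrow> real) \<Rightarrow> real) set
    \<Rightarrow> (((nat \<Rightarrow> real) \<Rightarrow> real) \<Rightarrow> real) \<Rightarrow> real \<Rightarrow> ennreal" where
  "comp_res (t::'w itself) cst D a F B I \<epsilon> =
     (INF A \<in> {A :: ('w, nat \<Rightarrow> real) ralg. in_Ares cst D a F A \<and> wce2 A I B \<le> ennreal (\<epsilon>\<^sup>2)}.
        cost_unr (cost_a cst D a) A B)"

definition strong_poly_tractable :: "(real \<Rightarrow> ennreal) \<Rightarrow> bool" where
  "strong_poly_tractable cmp \<longleftrightarrow>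
     (\<exists>C p. C \<ge> 0 \<and> p \<ge> 0 \<and> (\<forall>\<epsilon>>0. cmp \<epsilon> \<le> ennreal (C * \<epsilon> powr (-p))))"

definition tract_exp :: "(real \<Rightarrow> ennreal) \<Rightarrow> ereal" where
  "tract_exp cmp = Inf {ereal p | p. p \<ge> 0 \<and>
      (\<exists>C\<ge>0. \<forall>\<epsilon>>0. cmp \<epsilon> \<le> ennreal (C * \<epsilon> powr (-p)))}"

definition emin1_sq :: "'w itself \<Rightarrow> (nat \<Rightarrow> ennreal) \<Rightarrow> real set \<Rightarrow> (real \<Rightarrow> real) set
    \<Rightarrow> (real \<Rightarrow> real) set \<Rightarrow> ((real \<Rightarrow> real) \<Rightarrow> real) \<Rightarrow> nat \<Rightarrow> ennreal" where
  "emin1_sq (t::'w itself) cst D F B I N =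
     (INF A \<in> {A :: ('w, real) ralg. ra_valid A F \<and>
          (\<forall>f\<in>F. \<forall>\<omega>\<in>space (ra_space A). \<forall>i. enat i < ra_card A f \<omega> \<longrightarrow> ra_point A f \<omega> i \<in> D) \<and>
          cost_unr (\<lambda>_. cst 1) A B \<le> of_nat N}.
        wce2 A I B)"

definition ghat :: "(nat set \<Rightarrow> real) \<Rightarrow> real \<Rightarrow> nat set \<Rightarrow> real" where
  "ghat \<gamma> c u = \<gamma> u * c ^ card u"

text \<open>Nonempty u with positive cut-off weight gamma^(sigma)_u.\<close>
definition Sset :: "(nat set \<Rightarrow> real) \<Rightarrow> nat \<Rightarrow> nat set set" where
  "Sset \<gamma> \<sigma> = {u. finite u \<and> u \<noteq> {} \<and> card u \<le> \<sigma> \<and> \<gamma> u > 0}"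

definition idx_set :: "'a set \<Rightarrow> nat set" where
  "idx_set S = (if finite S then {1..card S} else {1..})"

definition nonincr_enum :: "('a \<Rightarrow> real) \<Rightarrow> 'a set \<Rightarrow> (nat \<Rightarrow> 'a) \<Rightarrow> bool" where
  "nonincr_enum g S u \<longleftrightarrow> bij_betw u (idx_set S) S \<and>
     (\<forall>i\<in>idx_set S. \<forall>j\<in>idx_set S. i \<le> j \<longrightarrow> g (u j) \<le> g (u i))"

definition decay :: "(nat set \<Rightarrow> real) \<Rightarrow> real \<Rightarrow> nat \<Rightarrow> ereal" where
  "decay \<gamma> c \<sigma> =
     (let S = Sset \<gamma> \<sigma>;
          u = (SOME u. nonincr_enum (ghat \<gamma> c) S u);
          w = (\<lambda>j::nat. if j \<in> idx_set S then ghat \<gamma> c (u j) else 0)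
      in Sup {ereal p | p. (\<lambda>j. w j * real j powr p) \<longlonglongrightarrow> 0})"

definition tstar :: "(nat set \<Rightarrow> real) \<Rightarrow> nat \<Rightarrow> ereal" where
  "tstar \<gamma> \<sigma> = Inf {ereal t | t. t \<ge> 0 \<and> (\<exists>C>0. \<forall>v. finite v \<longrightarrow>
       real (card {u \<in> Sset \<gamma> \<sigma>. u \<subseteq> v}) \<le> C * real (card v) powr t)}"

definition lb_term :: "(nat set \<Rightarrow> real) \<Rightarrow> real \<Rightarrow> real \<Rightarrow> nat \<Rightarrow> ereal" where
  "lb_term \<gamma> c s \<sigma> =
     (if decay \<gamma> c \<sigma> = \<infinity> then 0
      else 2 * min 1 (if tstar \<gamma> \<sigma> = 0 then \<infinity> else ereal s / tstar \<gamma> \<sigma>)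
             / (decay \<gamma> c \<sigma> - 1))"

end

theory Submission
  imports Defs
begin

text \<open>
  Since \<open>k\<close> vanishes at the anchor, the functions \<open>\<gamma> u * ku k u \<cdot> y\<close> lie in \<open>F\<close>, are orthogonal for
  different \<open>u\<close>, and vanish on \<open>Xva D a v\<close> unless \<open>u \<subseteq> v\<close>. Tensor powers of combinations of
  kernel sections approximating the representer of the univariate integral therefore give, for
  every algorithm in the restricted class, a fooling function built from sets \<open>u\<close> that none of the
  prescribed \<open>v i\<close> contains; it shows that the squared error is at least the sum of the
  corresponding \<open>ghat\<close> weights. A cost budget \<open>c\<close> covers at most a constant times
  \<open>c powr max 1 (t / s)\<close> sets, which bounds the decay of the weights from below. The bound \<open>2 / \<alpha>\<close>
  comes from embedding the univariate problem isometrically through the coordinate \<open>1\<close>.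
\<close>

text \<open>The restricted class makes counting possible: the sets \<open>v i\<close> depend neither
  on the input nor on the random element, so the uncovered \<open>u\<close> are known in advance and
  a function built from them looks like zero to the algorithm. The size of the error comes from one
  identity: the representer \<open>h\<close> of the univariate integral has its integral equal to
  its squared norm, and for the kernel \<open>k\<close> this number is \<open>C0 k \<rho>\<close>.
  So the ideal function, the sum of \<open>\<gamma> u\<close> times the tensor powers of
  \<open>h\<close>, has integral and squared norm both equal to the sum of the \<open>ghat\<close>
  weights; after normalisation this sum is its squared integral. The obstacle is that
  \<open>F\<close> is given only by axioms, without component spaces or tensor products. Components
  are extracted from sections at anchored points, tensor powers are formed for finite combinations
  only, and the ideal function enters through a limit of inequalities. The exponent
  \<open>1 + 2 / \<theta>\<close> with \<open>\<theta> = q * max 1 (t / s)\<close> is a balance: at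
  error \<open>\<epsilon>\<close> about \<open>J = \<epsilon> powr (- \<theta>)\<close> sets can be
  covered, and \<open>J\<close> times the \<open>J\<close>-th weight is at most of order
  \<open>\<epsilon> powr 2\<close>.\<close>

section \<open>Hilbert space geometry derived from the reproducing kernel axioms\<close>

locale rkhs =
  fixes K :: "'x \<Rightarrow> 'x \<Rightarrow> real" and X :: "'x set"
    and F :: "('x \<Rightarrow> real) set" and ip :: "('x \<Rightarrow> real) \<Rightarrow> ('x \<Rightarrow> real) \<Rightarrow> real"
  assumes is_rkhs: "is_rkhs K X F ip"
begin

definition ksec :: "'x \<Rightarrow> 'x \<Rightarrow> real" where
  "ksec y = (\<lambda>x. if x \<in> X then K x y else 0)"

lemma outside: "f \<in> F \<Longrightarrow> x \<notin> X \<Longrightarrow> f x = 0"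
  and zero_mem: "(\<lambda>x. 0) \<in> F"
  and add_mem: "f \<in> F \<Longrightarrow> g \<in> F \<Longrightarrow> (\<lambda>x. f x + g x) \<in> F"
  and scale_mem: "f \<in> F \<Longrightarrow> (\<lambda>x. c * f x) \<in> F"
  and ip_commute: "f \<in> F \<Longrightarrow> g \<in> F \<Longrightarrow> ip f g = ip g f"
  and ip_add_left: "f \<in> F \<Longrightarrow> g \<in> F \<Longrightarrow> h \<in> F \<Longrightarrow> ip (\<lambda>x. f x + g x) h = ip f h + ip g h"
  and ip_scale_left: "f \<in> F \<Longrightarrow> g \<in> F \<Longrightarrow> ip (\<lambda>x. c * f x) g = c * ip f g"
  and ip_nonneg: "f \<in> F \<Longrightarrow> 0 \<le> ip f f"
  and ip_eq_0D: "f \<in> F \<Longrightarrow> ip f f = 0 \<Longrightarrow> f = (\<lambda>x. 0)"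
  and ksec_mem: "y \<in> X \<Longrightarrow> ksec y \<in> F"
  and ip_ksec: "y \<in> X \<Longrightarrow> f \<in> F \<Longrightarrow> ip f (ksec y) = f y"
  using is_rkhs unfolding is_rkhs_def ksec_def by blast+

lemma complete:
  assumes "\<And>n. S n \<in> F"
    and "\<And>e. e > 0 \<Longrightarrow> \<exists>N. \<forall>m\<ge>N. \<forall>n\<ge>N.
        ip (\<lambda>x. S m x - S n x) (\<lambda>x. S m x - S n x) < e"
  obtains g where "g \<in> F" "(\<lambda>n. ip (\<lambda>x. S n x - g x) (\<lambda>x. S n x - g x)) \<longlonglongrightarrow> 0"
  using is_rkhs assms unfolding is_rkhs_def by blast

lemma diff_mem: "f \<in> F \<Longrightarrow> g \<in> F \<Longrightarrow> (\<lambda>x. f x - g x) \<in> F"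
  using add_mem[OF _ scale_mem[of g "-1"], of f] by simp

lemma sum_mem: "finite A \<Longrightarrow> (\<And>i. i \<in> A \<Longrightarrow> f i \<in> F) \<Longrightarrow> (\<lambda>x. \<Sum>i\<in>A. f i x) \<in> F"
proof (induction A rule: finite_induct)
  case empty
  then show ?case by (simp add: zero_mem)
next
  case (insert a A)
  have "(\<lambda>x. f a x + (\<Sum>i\<in>A. f i x)) \<in> F"
    by (rule add_mem[OF insert.prems[OF insertI1] insert.IH[OF insert.prems[OF insertI2]]])
  then show ?case unfolding sum.insert[OF insert.hyps(1,2)] .
qed

lemma ip_add_right: "f \<in> F \<Longrightarrow> g \<in> F \<Longrightarrow> h \<in> F \<Longrightarrow> ip h (\<lambda>x. f x + g x) = ip h f + ip h g"
  using ip_add_left[of f g h] ip_commute[of h "\<lambda>x. f x + g x"] ip_commute[of h f]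
    ip_commute[of h g] add_mem[of f g] by simp

lemma ip_scale_right: "f \<in> F \<Longrightarrow> g \<in> F \<Longrightarrow> ip g (\<lambda>x. c * f x) = c * ip g f"
  using ip_scale_left[of f g c] ip_commute[of g "\<lambda>x. c * f x"] ip_commute[of g f]
    scale_mem[of f c] by simp

lemma ip_diff_left: "f \<in> F \<Longrightarrow> g \<in> F \<Longrightarrow> h \<in> F \<Longrightarrow> ip (\<lambda>x. f x - g x) h = ip f h - ip g h"
  using ip_add_left[OF _ scale_mem[of g "-1"], of f h] ip_scale_left[of g h "-1"] by simp

lemma ip_diff_right: "f \<in> F \<Longrightarrow> g \<in> F \<Longrightarrow> h \<in> F \<Longrightarrow> ip h (\<lambda>x. f x - g x) = ip h f - ip h g"
  using ip_diff_left[of f g h] ip_commute[of h "\<lambda>x. f x - g x"] ip_commute[of h f]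
    ip_commute[of h g] diff_mem[of f g] by simp

lemma ip_zero_left: "g \<in> F \<Longrightarrow> ip (\<lambda>x. 0) g = 0"
  using ip_scale_left[of g g 0] by simp

lemma ip_zero_right: "g \<in> F \<Longrightarrow> ip g (\<lambda>x. 0) = 0"
  using ip_scale_right[of g g 0] by simp

lemma ip_sum_left:
  "finite A \<Longrightarrow> (\<And>i. i \<in> A \<Longrightarrow> f i \<in> F) \<Longrightarrow> g \<in> F \<Longrightarrow>
    ip (\<lambda>x. \<Sum>i\<in>A. f i x) g = (\<Sum>i\<in>A. ip (f i) g)"
proof (induction A rule: finite_induct)
  case empty
  then show ?case by (simp add: ip_zero_left)
next
  case (insert a A)
  have "(\<lambda>x. \<Sum>i\<in>A. f i x) \<in> F"
    by (rule sum_mem[OF insert.hyps(1) insert.prems(1)[OF insertI2]])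
  from ip_add_left[OF insert.prems(1)[OF insertI1] this insert.prems(2)]
  show ?case
    by (simp only: sum.insert[OF insert.hyps(1,2)] insert.IH[OF insert.prems(1)[OF insertI2] insert.prems(2)])
qed

lemma ip_sum_right:
  "finite A \<Longrightarrow> (\<And>i. i \<in> A \<Longrightarrow> f i \<in> F) \<Longrightarrow> g \<in> F \<Longrightarrow>
    ip g (\<lambda>x. \<Sum>i\<in>A. f i x) = (\<Sum>i\<in>A. ip g (f i))"
proof (induction A rule: finite_induct)
  case empty
  then show ?case by (simp add: ip_zero_right)
next
  case (insert a A)
  have "(\<lambda>x. \<Sum>i\<in>A. f i x) \<in> F"
    by (rule sum_mem[OF insert.hyps(1) insert.prems(1)[OF insertI2]])
  from ip_add_right[OF insert.prems(1)[OF insertI1] this insert.prems(2)]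
  show ?case
    by (simp only: sum.insert[OF insert.hyps(1,2)] insert.IH[OF insert.prems(1)[OF insertI2] insert.prems(2)])
qed

lemmas ip_simps = ip_add_left ip_add_right ip_diff_left ip_diff_right ip_scale_left ip_scale_right
  add_mem diff_mem scale_mem

lemma ip_ksec_ksec: "y \<in> X \<Longrightarrow> z \<in> X \<Longrightarrow> ip (ksec y) (ksec z) = K z y"
  by (simp add: ip_ksec ksec_mem) (simp add: ksec_def)

lemma cauchy_schwarz:
  assumes "f \<in> F" "g \<in> F"
  shows "(ip f g)\<^sup>2 \<le> ip f f * ip g g"
proof (cases "ip g g = 0")
  case True
  then have "g = (\<lambda>x. 0)" using ip_eq_0D assms by blast
  then show ?thesis using assms by (simp add: ip_zero_right)
next
  case False
  then have pos: "ip g g > 0" using ip_nonneg[OF assms(2)] by simp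
  define t where "t = ip f g / ip g g"
  have "0 \<le> ip (\<lambda>x. f x - t * g x) (\<lambda>x. f x - t * g x)"
    using assms by (intro ip_nonneg diff_mem scale_mem)
  also have "\<dots> = ip f f - 2 * t * ip f g + t\<^sup>2 * ip g g"
    using assms by (simp add: ip_simps ip_commute[of g f] power2_eq_square algebra_simps)
  also have "\<dots> = ip f f - (ip f g)\<^sup>2 / ip g g"
    using False by (simp add: t_def power2_eq_square field_simps)
  finally show ?thesis using pos by (simp add: field_simps)
qed

lemma eval_bound: "f \<in> F \<Longrightarrow> x \<in> X \<Longrightarrow> (f x)\<^sup>2 \<le> ip f f * K x x"
  using cauchy_schwarz[of f "ksec x"] ip_ksec_ksec[of x x] ip_ksec[of x f] ksec_mem[of x] by simp

lemma ip_tendsto: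
  assumes S: "\<And>n. S n \<in> F" and g: "g \<in> F" and f: "f \<in> F"
    and lim: "(\<lambda>n. ip (\<lambda>x. S n x - g x) (\<lambda>x. S n x - g x)) \<longlonglongrightarrow> 0"
  shows "(\<lambda>n. ip (S n) f) \<longlonglongrightarrow> ip g f"
proof -
  have "(\<lambda>n. (ip (S n) f - ip g f)\<^sup>2) \<longlonglongrightarrow> 0"
  proof (rule tendsto_sandwich[OF _ _ tendsto_const])
    show "(\<lambda>n. ip (\<lambda>x. S n x - g x) (\<lambda>x. S n x - g x) * ip f f) \<longlonglongrightarrow> 0"
      using tendsto_mult_left_zero[OF lim] .
    show "\<forall>\<^sub>F n in sequentially. (ip (S n) f - ip g f)\<^sup>2
        \<le> ip (\<lambda>x. S n x - g x) (\<lambda>x. S n x - g x) * ip f f"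
      using cauchy_schwarz[OF diff_mem[OF S g] f] by (simp add: ip_diff_left S g f)
  qed simp
  then have "(\<lambda>n. ip (S n) f - ip g f) \<longlonglongrightarrow> 0"
    by (subst (asm) power_tendsto_0_iff) auto
  then show ?thesis by (simp add: LIM_zero_iff)
qed

lemma ip_self_tendsto:
  assumes S: "\<And>n. S n \<in> F" and g: "g \<in> F"
    and lim: "(\<lambda>n. ip (\<lambda>x. S n x - g x) (\<lambda>x. S n x - g x)) \<longlonglongrightarrow> 0"
  shows "(\<lambda>n. ip (S n) (S n)) \<longlonglongrightarrow> ip g g"
proof -
  have "(\<lambda>n. ip (\<lambda>x. S n x - g x) (\<lambda>x. S n x - g x) + 2 * ip (S n) g - ip g g) \<longlonglongrightarrow>
      0 + 2 * ip g g - ip g g"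
    by (intro tendsto_intros lim ip_tendsto[OF S g g])
  then show ?thesis
    by (simp add: ip_simps S g ip_commute[OF g S] algebra_simps)
qed

lemma pointwise_tendsto:
  assumes "\<And>n. S n \<in> F" "g \<in> F"
    and "(\<lambda>n. ip (\<lambda>x. S n x - g x) (\<lambda>x. S n x - g x)) \<longlonglongrightarrow> 0"
  shows "(\<lambda>n. S n x) \<longlonglongrightarrow> g x"
proof (cases "x \<in> X")
  case True
  then show ?thesis
    using ip_tendsto[OF assms(1,2) ksec_mem assms(3), of x] assms by (simp add: ip_ksec)
next
  case False
  then show ?thesis using outside[OF assms(1)] outside[OF assms(2)] by simp
qed

text \<open>The representer is the limit of a minimising sequence of
  \<open>\<lambda>v. ip v v - 2 * L v\<close>, which is Cauchy by the parallelogram law.\<close>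

lemma riesz:
  assumes V: "V \<subseteq> F" and V0: "(\<lambda>x. 0) \<in> V"
    and Vadd: "\<And>f g. f \<in> V \<Longrightarrow> g \<in> V \<Longrightarrow> (\<lambda>x. f x + g x) \<in> V"
    and Vscale: "\<And>c f. f \<in> V \<Longrightarrow> (\<lambda>x. c * f x) \<in> V"
    and Ladd: "\<And>f g. f \<in> V \<Longrightarrow> g \<in> V \<Longrightarrow> L (\<lambda>x. f x + g x) = L f + L g"
    and Lscale: "\<And>c f. f \<in> V \<Longrightarrow> L (\<lambda>x. c * f x) = c * L f"
    and B: "0 \<le> B" and Lbound: "\<And>f. f \<in> V \<Longrightarrow> (L f)\<^sup>2 \<le> B * ip f f"
  shows "\<exists>g\<in>F. \<exists>S. (\<forall>n. S n \<in> V) \<and> (\<forall>v\<in>V. ip g v = L v) \<and>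
    (\<lambda>n. ip (\<lambda>x. S n x - g x) (\<lambda>x. S n x - g x)) \<longlonglongrightarrow> 0"
proof -
  \<comment> \<open>\<open>V\<close> need not be closed, so the representer is only found in
    \<open>F\<close>; the sequence \<open>S\<close> in the conclusion records that it lies in the
    closure of \<open>V\<close>.\<close>
  define J where "J v = ip v v - 2 * L v" for v
  have VF: "v \<in> F" if "v \<in> V" for v using V that by (rule subsetD)
  have J_lower: "- B \<le> J v" if v: "v \<in> V" for v
  proof -
    have nn: "0 \<le> ip v v" using ip_nonneg[OF VF[OF v]] .
    have "(2 * L v)\<^sup>2 \<le> 4 * (B * ip v v)" using Lbound[OF v] by (simp add: power2_eq_square)
    also have "\<dots> \<le> (B + ip v v)\<^sup>2" using zero_le_power2[of "B - ip v v"]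
      by (simp add: power2_eq_square algebra_simps)
    finally have "2 * L v \<le> B + ip v v" by (rule power2_le_imp_le) (use B nn in linarith)
    then show ?thesis by (simp add: J_def)
  qed
  define m where "m = Inf (J ` V)"
  have bdd: "bdd_below (J ` V)" using J_lower by (intro bdd_belowI[of _ "-B"]) auto
  have m_le: "m \<le> J v" if "v \<in> V" for v
    unfolding m_def using bdd that by (intro cInf_lower) auto
  have "\<exists>v\<in>V. J v < m + 1 / real (Suc n)" for n
  proof -
    have "Inf (J ` V) < m + 1 / real (Suc n)" by (simp add: m_def)
    then show ?thesis using cInf_lessD[of "J ` V"] V0 by blast
  qed
  then obtain S where SV: "\<And>n. S n \<in> V" and SJ: "\<And>n. J (S n) < m + 1 / real (Suc n)" by metis
  have SF: "S n \<in> F" for n by (rule VF[OF SV])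
  have J_expand: "J (\<lambda>x. u x + t * v x) = J u + 2 * t * (ip u v - L v) + t\<^sup>2 * ip v v"
    if "u \<in> V" "v \<in> V" for u v t
    using that by (simp add: J_def VF ip_simps ip_commute[of v u] Ladd Lscale Vscale
        power2_eq_square algebra_simps)
  have cauchy: "ip (\<lambda>x. S i x - S j x) (\<lambda>x. S i x - S j x) \<le> 2 / real (Suc i) + 2 / real (Suc j)"
    for i j
  proof -
    have mid: "(\<lambda>x. 1/2 * (S i x + S j x)) \<in> V" using SV by (intro Vscale Vadd)
    have "L (\<lambda>x. 1/2 * (S i x + S j x)) = 1/2 * (L (S i) + L (S j))"
      by (subst Lscale) (auto simp: Ladd SV Vadd)
    moreover have "ip (\<lambda>x. 1/2 * (S i x + S j x)) (\<lambda>x. 1/2 * (S i x + S j x))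
        = 1/4 * (ip (S i) (S i) + 2 * ip (S i) (S j) + ip (S j) (S j))"
      by (subst ip_scale_left, (intro add_mem scale_mem SF)+,
          subst ip_scale_right, (intro add_mem scale_mem SF)+)
        (simp add: ip_simps SF ip_commute[of "S j" "S i"])
    ultimately have "ip (\<lambda>x. S i x - S j x) (\<lambda>x. S i x - S j x)
        = 2 * J (S i) + 2 * J (S j) - 4 * J (\<lambda>x. 1/2 * (S i x + S j x))"
      by (simp add: J_def ip_simps SF ip_commute[of "S j" "S i"])
    then show ?thesis using SJ[of i] SJ[of j] m_le[OF mid] by simp
  qed
  have "\<exists>N. \<forall>m\<ge>N. \<forall>n\<ge>N. ip (\<lambda>x. S m x - S n x) (\<lambda>x. S m x - S n x) < e" if "e > 0" for e
  proof -
    have "0 < e / 4" using that by simp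
    then obtain N where N: "1 / real (Suc N) < e / 4"
      by (metis reals_Archimedean inverse_eq_divide)
    have "ip (\<lambda>x. S m x - S n x) (\<lambda>x. S m x - S n x) < e" if "m \<ge> N" "n \<ge> N" for m n
    proof -
      have *: "2 / real (Suc l) \<le> 2 / real (Suc N)" if "l \<ge> N" for l
        using that by (intro divide_left_mono) auto
      show ?thesis using *[OF that(1)] *[OF that(2)] cauchy[of m n] N by simp
    qed
    then show ?thesis by blast
  qed
  then obtain g where g: "g \<in> F"
    and lim: "(\<lambda>n. ip (\<lambda>x. S n x - g x) (\<lambda>x. S n x - g x)) \<longlonglongrightarrow> 0"
    by (rule complete[of S, OF SF])
  have "ip g v = L v" if v: "v \<in> V" for v
  proof -
    define \<delta> where "\<delta> = ip g v - L v"
    define N where "N = ip v v"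
    have N0: "0 \<le> N" using ip_nonneg VF v by (simp add: N_def)
    have var: "0 \<le> 2 * t * \<delta> + t\<^sup>2 * N" for t
    proof (rule LIMSEQ_le_const)
      have "(\<lambda>n. 2 * t * (ip (S n) v - L v) + t\<^sup>2 * N + 1 / real (Suc n))
          \<longlonglongrightarrow> 2 * t * (ip g v - L v) + t\<^sup>2 * N + 0"
        by (intro tendsto_intros ip_tendsto SF g VF v lim lim_1_over_n[THEN LIMSEQ_Suc])
      then show "(\<lambda>n. 2 * t * (ip (S n) v - L v) + t\<^sup>2 * N + 1 / real (Suc n))
          \<longlonglongrightarrow> 2 * t * \<delta> + t\<^sup>2 * N" by (simp add: \<delta>_def)
      have "0 \<le> 2 * t * (ip (S n) v - L v) + t\<^sup>2 * N + 1 / real (Suc n)" for n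
        using m_le[OF Vadd[OF SV Vscale[OF v]], of n t] SJ[of n] J_expand[OF SV v, of n t]
        by (simp add: N_def)
      then show "\<exists>N'. \<forall>n\<ge>N'. 0 \<le> 2 * t * (ip (S n) v - L v) + t\<^sup>2 * N + 1 / real (Suc n)"
        by blast
    qed
    \<comment> \<open>With \<open>t = - d\<close> the quadratic in \<open>var\<close> becomes
      \<open>- (d^2 * (N + 2))\<close>, which forces \<open>d = 0\<close>. The denominator
      \<open>N + 1\<close> also covers \<open>v = 0\<close>.\<close>
    define d where "d = \<delta> / (N + 1)"
    have \<delta>: "\<delta> = d * (N + 1)" using N0 by (simp add: d_def)
    have "0 \<le> 2 * (- d) * \<delta> + (- d)\<^sup>2 * N" by (rule var)
    also have "\<dots> = - (d\<^sup>2 * (N + 2))" by (simp add: \<delta> power2_eq_square algebra_simps)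
    finally have "d\<^sup>2 \<le> 0" using N0 by (simp add: mult_le_0_iff)
    then have "\<delta> = 0" by (simp add: \<delta>)
    then show ?thesis by (simp add: \<delta>_def)
  qed
  then show ?thesis using g SV lim by (intro bexI[OF _ g] exI[of _ S]) simp
qed

section \<open>Finite combinations of kernel sections and their density\<close>

definition kspan :: "('x \<Rightarrow> real) set" where
  "kspan = {f. \<exists>Y b. finite Y \<and> Y \<subseteq> X \<and> f = (\<lambda>x. \<Sum>y\<in>Y. b y * ksec y x)}"

lemma kspanI: "finite Y \<Longrightarrow> Y \<subseteq> X \<Longrightarrow> (\<lambda>x. \<Sum>y\<in>Y. b y * ksec y x) \<in> kspan"
  by (auto simp: kspan_def)

lemma kspanE:
  assumes "f \<in> kspan"
  obtains Y b where "finite Y" "Y \<subseteq> X" "f = (\<lambda>x. \<Sum>y\<in>Y. b y * ksec y x)"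
  using assms unfolding kspan_def by (elim CollectE exE conjE)

lemma kspan_subset: "kspan \<subseteq> F"
proof
  fix f assume "f \<in> kspan"
  then obtain Y b where Y: "finite Y" "Y \<subseteq> X" "f = (\<lambda>x. \<Sum>y\<in>Y. b y * ksec y x)"
    by (rule kspanE)
  have "(\<lambda>x. \<Sum>y\<in>Y. b y * ksec y x) \<in> F"
    using Y by (intro sum_mem scale_mem ksec_mem) auto
  then show "f \<in> F" by (simp add: Y(3))
qed

lemma kspan_add:
  assumes u: "u \<in> kspan" and v: "v \<in> kspan"
  shows "(\<lambda>x. u x + v x) \<in> kspan"
proof -
  obtain Y b where Y: "finite Y" "Y \<subseteq> X" "u = (\<lambda>x. \<Sum>y\<in>Y. b y * ksec y x)"
    by (rule kspanE[OF u])
  obtain Z c where Z: "finite Z" "Z \<subseteq> X" "v = (\<lambda>x. \<Sum>y\<in>Z. c y * ksec y x)"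
    by (rule kspanE[OF v])
  have "u x + v x = (\<Sum>y\<in>Y\<union>Z. ((if y \<in> Y then b y else 0) + (if y \<in> Z then c y else 0)) * ksec y x)" for x
  proof -
    have "u x = (\<Sum>y\<in>Y\<union>Z. (if y \<in> Y then b y else 0) * ksec y x)"
      unfolding Y(3) using Y Z by (intro sum.mono_neutral_cong_left) auto
    moreover have "v x = (\<Sum>y\<in>Y\<union>Z. (if y \<in> Z then c y else 0) * ksec y x)"
      unfolding Z(3) using Y Z by (intro sum.mono_neutral_cong_left) auto
    ultimately show ?thesis by (simp add: sum.distrib distrib_right)
  qed
  then have "(\<lambda>x. u x + v x) = (\<lambda>x. \<Sum>y\<in>Y\<union>Z. ((if y \<in> Y then b y else 0) + (if y \<in> Z then c y else 0)) * ksec y x)"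
    by (rule ext)
  then show ?thesis using kspanI[of "Y \<union> Z"] Y(1,2) Z(1,2) by (simp only: Un_subset_iff finite_Un)
qed

lemma kspan_scale:
  assumes u: "u \<in> kspan"
  shows "(\<lambda>x. t * u x) \<in> kspan"
proof -
  obtain Y b where Y: "finite Y" "Y \<subseteq> X" "u = (\<lambda>x. \<Sum>y\<in>Y. b y * ksec y x)"
    by (rule kspanE[OF u])
  then show ?thesis using kspanI[of Y "\<lambda>y. t * b y"] by (simp add: sum_distrib_left mult.assoc)
qed

lemma kspan_diff: "u \<in> kspan \<Longrightarrow> v \<in> kspan \<Longrightarrow> (\<lambda>x. u x - v x) \<in> kspan"
  using kspan_add[OF _ kspan_scale[of v "-1"], of u] by simp

text \<open>Only squared norms occur in the axioms, so the triangle inequality is replaced by its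
  squared form with factor 2, which follows from the nonnegative squared norm of the sum of the two
  deviations.\<close>

lemma convergent_imp_cauchy:
  assumes S: "\<And>n. S n \<in> F" and g: "g \<in> F"
    and lim: "(\<lambda>n. ip (\<lambda>x. S n x - g x) (\<lambda>x. S n x - g x)) \<longlonglongrightarrow> 0" and e: "e > 0"
  shows "\<exists>N. \<forall>m\<ge>N. \<forall>n\<ge>N. ip (\<lambda>x. S m x - S n x) (\<lambda>x. S m x - S n x) < e"
proof -
  have bound: "ip (\<lambda>x. S m x - S n x) (\<lambda>x. S m x - S n x)
      \<le> 2 * ip (\<lambda>x. S m x - g x) (\<lambda>x. S m x - g x) + 2 * ip (\<lambda>x. S n x - g x) (\<lambda>x. S n x - g x)" for m n
  proof -
    have "0 \<le> ip (\<lambda>x. (S m x - g x) + (S n x - g x)) (\<lambda>x. (S m x - g x) + (S n x - g x))"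
      by (intro ip_nonneg add_mem diff_mem S g)
    then show ?thesis
      by (simp add: ip_simps S g ip_commute[OF g S] ip_commute[OF S[of n] S[of m]])
  qed
  obtain N where N: "\<And>n. n \<ge> N \<Longrightarrow> ip (\<lambda>x. S n x - g x) (\<lambda>x. S n x - g x) < e / 4"
    using order_tendstoD(2)[OF lim, of "e/4"] e unfolding eventually_sequentially by auto
  have "ip (\<lambda>x. S m x - S n x) (\<lambda>x. S m x - S n x) < e" if "m \<ge> N" "n \<ge> N" for m n
    using bound[of m n] N[OF that(1)] N[OF that(2)] by linarith
  then show ?thesis by blast
qed

text \<open>\<open>riesz\<close> applied to \<open>V = kspan\<close> and the functional
  \<open>ip f\<close> gives a limit \<open>g\<close> of elements of \<open>kspan\<close> with the
  same inner products with all sections as \<open>f\<close>. These inner products are point values,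
  so \<open>g = f\<close>.\<close>

lemma kspan_dense:
  assumes f: "f \<in> F"
  obtains S where "\<forall>n. S n \<in> kspan"
    "(\<lambda>n. ip (\<lambda>x. S n x - f x) (\<lambda>x. S n x - f x)) \<longlonglongrightarrow> 0"
proof -
  have zero: "(\<lambda>x. 0) \<in> kspan" using kspanI[of "{}"] by simp
  have mem: "v \<in> F" if "v \<in> kspan" for v using kspan_subset that by (rule subsetD)
  have Ladd: "ip f (\<lambda>x. u x + v x) = ip f u + ip f v" if "u \<in> kspan" "v \<in> kspan" for u v
    by (rule ip_add_right[OF mem[OF that(1)] mem[OF that(2)] f])
  have Lscale: "ip f (\<lambda>x. c * u x) = c * ip f u" if "u \<in> kspan" for u c
    by (rule ip_scale_right[OF mem[OF that] f])
  obtain g where g: "g \<in> F" and ex: "\<exists>S. (\<forall>n. S n \<in> kspan) \<and> (\<forall>v\<in>kspan. ip g v = ip f v) \<and>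
      (\<lambda>n. ip (\<lambda>x. S n x - g x) (\<lambda>x. S n x - g x)) \<longlonglongrightarrow> 0"
    by (rule bexE[OF riesz[of kspan "ip f" "ip f f", OF kspan_subset zero kspan_add kspan_scale Ladd Lscale
        ip_nonneg[OF f] cauchy_schwarz[OF f mem]]])
  obtain S where *: "(\<forall>n. S n \<in> kspan) \<and> (\<forall>v\<in>kspan. ip g v = ip f v) \<and>
      (\<lambda>n. ip (\<lambda>x. S n x - g x) (\<lambda>x. S n x - g x)) \<longlonglongrightarrow> 0"
    by (rule exE[OF ex])
  then have S: "S n \<in> kspan" and gS: "v \<in> kspan \<Longrightarrow> ip g v = ip f v" for n v
    by simp_all
  have lim: "(\<lambda>n. ip (\<lambda>x. S n x - g x) (\<lambda>x. S n x - g x)) \<longlonglongrightarrow> 0"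
    using * by (elim conjE)
  have "g x = f x" for x
  proof (cases "x \<in> X")
    case True
    then have "ksec x \<in> kspan" using kspanI[of "{x}" "\<lambda>_. 1"] by simp
    then have "ip g (ksec x) = ip f (ksec x)" by (rule gS)
    then show ?thesis by (simp add: ip_ksec[OF True] g f)
  qed (use outside[OF g] outside[OF f] in simp)
  then have gf: "g = f" by (rule ext)
  show thesis by (rule that[OF allI[OF S] lim[unfolded gf]])
qed

end

section \<open>The anchored weighted kernel and its orthogonal components\<close>

locale weighted_kernel =
  fixes D :: "real set" and a :: real and k :: "real \<Rightarrow> real \<Rightarrow> real"
    and \<rho> :: "real measure" and \<gamma> :: "nat set \<Rightarrow> real"
    and F :: "((nat \<Rightarrow> real) \<Rightarrow> real) set"
    and ip :: "((nat \<Rightarrow> real) \<Rightarrow> real) \<Rightarrow> ((nat \<Rightarrow> real) \<Rightarrow> real) \<Rightarrow> real"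
    and F1 :: "(real \<Rightarrow> real) set"
    and ip1 :: "(real \<Rightarrow> real) \<Rightarrow> (real \<Rightarrow> real) \<Rightarrow> real"
  assumes a_in: "a \<in> D"
    and k_kernel: "psd_kernel k D"
    and k_anchor: "k a a = 0"
    and rho_prob: "prob_space \<rho>"
    and rho_sets: "sets \<rho> = sets (restrict_space borel D)"
    and k_meas: "(\<lambda>(x, y). k x y) \<in> borel_measurable (\<rho> \<Otimes>\<^sub>M \<rho>)"
    and M_finite: "integrable \<rho> (\<lambda>x. k x x)"
    and gamma_nonneg: "\<forall>u. 0 \<le> \<gamma> u"
    and gamma_summable: "(\<lambda>u. \<gamma> u * Mk k \<rho> ^ card u) summable_on {u. finite u}"
    and C0_pos: "C0 k \<rho> > 0"
    and H_rkhs: "is_rkhs (Kgam k \<gamma>) (Xdom k \<gamma> D) F ip"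
    and gamma1: "\<gamma> {1} > 0"
    and H1_rkhs: "is_rkhs (\<lambda>x y. \<gamma> {1} * k x y) D F1 ip1"
begin

sublocale H: rkhs "Kgam k \<gamma>" "Xdom k \<gamma> D" F ip
  by unfold_locales (rule H_rkhs)

sublocale H1: rkhs "\<lambda>x y. \<gamma> {1} * k x y" D F1 ip1
  by unfold_locales (rule H1_rkhs)

declare One_nat_def [simp del]

abbreviation X :: "(nat \<Rightarrow> real) set" where "X \<equiv> Xdom k \<gamma> D"

lemma k_sym: "x \<in> D \<Longrightarrow> y \<in> D \<Longrightarrow> k x y = k y x"
  using k_kernel by (auto simp: psd_kernel_def)

text \<open>Every function in \<open>F1\<close> vanishes at \<open>a\<close>, because
  \<open>eval_bound\<close> controls its value there by \<open>k a a = 0\<close>. This is applied to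
  the section at \<open>x\<close>.\<close>

lemma k_anchor_left: "x \<in> D \<Longrightarrow> k a x = 0"
  using H1.eval_bound[OF H1.ksec_mem a_in, of x] k_anchor a_in gamma1
  by (simp add: H1.ksec_def)

lemma k_anchor_right: "x \<in> D \<Longrightarrow> k x a = 0"
  by (simp only: k_sym[OF _ a_in] k_anchor_left)

lemma k_nonneg: "x \<in> D \<Longrightarrow> 0 \<le> k x x"
  using H1.ip_nonneg[OF H1.ksec_mem, of x] H1.ip_ksec_ksec[of x x] gamma1
  by (simp add: zero_le_mult_iff)

text \<open>At such a point every \<open>ku k w\<close> with \<open>w\<close> not contained in
  \<open>u\<close> vanishes. For finite \<open>u\<close> the series for \<open>Kgam\<close> is then
  a finite sum, and the point lies in \<open>X\<close> without any convergence question.\<close>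

definition anch :: "nat set \<Rightarrow> (nat \<Rightarrow> real) \<Rightarrow> nat \<Rightarrow> real" where
  "anch u y = (\<lambda>j. if j \<in> u then y j else a)"

lemma anch_in_D: "(\<And>j. j \<in> u \<Longrightarrow> y j \<in> D) \<Longrightarrow> anch u y j \<in> D"
  by (simp add: anch_def a_in)

lemma Xdom_in_D: "x \<in> X \<Longrightarrow> x j \<in> D"
  by (simp add: Xdom_def)

lemma ku_anch_right:
  assumes "finite w" "\<And>j. x j \<in> D"
  shows "ku k w x (anch u y) = (if w \<subseteq> u then ku k w x y else 0)"
proof (cases "w \<subseteq> u")
  case True
  then show ?thesis by (auto simp: ku_def anch_def intro!: prod.cong)
next
  case False
  then obtain j where "j \<in> w" "j \<notin> u" by blast
  then show ?thesis
    using assms False by (auto simp: ku_def anch_def k_anchor_right intro!: bexI[of _ j])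
qed

lemma ku_anch_left:
  assumes "finite w" "\<And>j. y j \<in> D"
  shows "ku k w (anch u x) y = (if w \<subseteq> u then ku k w x y else 0)"
proof (cases "w \<subseteq> u")
  case True
  then show ?thesis by (auto simp: ku_def anch_def intro!: prod.cong)
next
  case False
  then obtain j where "j \<in> w" "j \<notin> u" by blast
  then show ?thesis
    using assms False by (auto simp: ku_def anch_def k_anchor_left intro!: bexI[of _ j])
qed

lemma anch_in_Xdom:
  assumes "finite u" "\<And>j. j \<in> u \<Longrightarrow> y j \<in> D"
  shows "anch u y \<in> X"
proof -
  have D: "anch u y j \<in> D" for j using assms anch_in_D by blast
  have "(\<lambda>w. \<gamma> w * ku k w (anch u y) (anch u y)) summable_on {u. finite u} \<longleftrightarrow>
        (\<lambda>w. \<gamma> w * ku k w (anch u y) y) summable_on Pow u"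
    using assms(1) D
    by (intro summable_on_cong_neutral) (auto simp: ku_anch_right intro: finite_subset)
  then show ?thesis using assms(1) D by (simp add: Xdom_def)
qed

lemma Xva_subset_Xdom:
  assumes "finite v" "x \<in> Xva D a v"
  shows "x \<in> X"
proof -
  have "anch v x = x" using assms(2) by (auto simp: anch_def Xva_def)
  then show ?thesis using anch_in_Xdom[of v x] assms by (auto simp: Xva_def)
qed

lemma Kgam_anch:
  assumes "finite u" "\<And>j. x j \<in> D"
  shows "Kgam k \<gamma> x (anch u y) = (\<Sum>w\<in>Pow u. \<gamma> w * ku k w x y)"
proof -
  have "Kgam k \<gamma> x (anch u y) = (\<Sum>\<^sub>\<infinity>w\<in>Pow u. \<gamma> w * ku k w x y)"
    unfolding Kgam_def using assms
    by (intro infsum_cong_neutral) (auto simp: ku_anch_right intro: finite_subset)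
  then show ?thesis using assms(1) by simp
qed

text \<open>The section of the component kernel \<open>\<gamma> u * ku k u\<close>, cut off outside
  \<open>X\<close>. It stands in for the component space, which is never constructed.\<close>

definition usec :: "nat set \<Rightarrow> (nat \<Rightarrow> real) \<Rightarrow> (nat \<Rightarrow> real) \<Rightarrow> real" where
  "usec u y = (\<lambda>x. if x \<in> X then \<gamma> u * ku k u x y else 0)"

text \<open>The section of \<open>Kgam\<close> at \<open>anch u y\<close> is the sum of
  \<open>usec w y\<close> over all \<open>w \<subseteq> u\<close>; this is solved for the top term.
  Membership in \<open>F\<close> and orthogonality both follow from it by induction over proper
  subsets.\<close>

lemma usec_recursion:
  assumes "finite u"
  shows "usec u y = (\<lambda>x. H.ksec (anch u y) x - (\<Sum>w\<in>Pow u - {u}. usec w y x))"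
proof
  fix x
  show "usec u y x = H.ksec (anch u y) x - (\<Sum>w\<in>Pow u - {u}. usec w y x)"
  proof (cases "x \<in> X")
    case True
    then have "Kgam k \<gamma> x (anch u y) = (\<Sum>w\<in>Pow u. usec w y x)"
      using Kgam_anch[OF assms Xdom_in_D] by (simp add: usec_def)
    also have "\<dots> = usec u y x + (\<Sum>w\<in>Pow u - {u}. usec w y x)"
      by (rule sum.remove) (use assms in auto)
    finally show ?thesis using True by (simp add: H.ksec_def)
  qed (simp add: usec_def H.ksec_def)
qed

lemma usec_mem:
  assumes "finite u" "\<And>j. y j \<in> D"
  shows "usec u y \<in> F"
  using assms(1)
proof (induction rule: finite_psubset_induct)
  case (psubset u)
  show ?case
    unfolding usec_recursion[OF psubset.hyps]
  proof (intro H.diff_mem H.sum_mem)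
    show "H.ksec (anch u y) \<in> F" by (intro H.ksec_mem anch_in_Xdom psubset.hyps assms(2))
    show "finite (Pow u - {u})" using psubset.hyps by simp
    show "usec w y \<in> F" if "w \<in> Pow u - {u}" for w using psubset.IH[of w] that by blast
  qed
qed

text \<open>The reproducing property at \<open>anch u y\<close> yields the value of
  \<open>usec v z\<close> there, which is \<open>\<gamma> v * ku k v y z\<close> if
  \<open>v \<subseteq> u\<close> and \<open>0\<close> otherwise. When \<open>v\<close> is a proper
  subset of \<open>u\<close>, the induction hypothesis subtracts exactly this term, so only
  \<open>v = u\<close> survives.\<close>

lemma ip_usec_usec:
  assumes "finite u" "finite v" and y: "\<And>j. y j \<in> D" and z: "\<And>j. z j \<in> D"
  shows "ip (usec v z) (usec u y) = (if u = v then \<gamma> u * ku k u y z else 0)"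
  using assms(1)
proof (induction rule: finite_psubset_induct)
  case (psubset u)
  have fin: "finite (Pow u - {u})" using psubset.hyps by simp
  have finw: "finite w" if "w \<in> Pow u - {u}" for w
    using that psubset.hyps finite_subset by blast
  have vz: "usec v z \<in> F" by (rule usec_mem[OF assms(2) z])
  have w: "usec w y \<in> F" if "w \<in> Pow u - {u}" for w by (rule usec_mem[OF finw[OF that] y])
  have X: "anch u y \<in> X" by (intro anch_in_Xdom psubset.hyps y)
  have "ip (usec v z) (usec u y) =
      ip (usec v z) (\<lambda>x. H.ksec (anch u y) x - (\<Sum>w\<in>Pow u - {u}. usec w y x))"
    by (simp only: usec_recursion[OF psubset.hyps, of y, symmetric])
  also have "\<dots> = ip (usec v z) (H.ksec (anch u y)) -
      ip (usec v z) (\<lambda>x. \<Sum>w\<in>Pow u - {u}. usec w y x)"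
    by (rule H.ip_diff_right[OF H.ksec_mem[OF X] H.sum_mem[OF fin w] vz])
  also have "ip (usec v z) (\<lambda>x. \<Sum>w\<in>Pow u - {u}. usec w y x) =
      (\<Sum>w\<in>Pow u - {u}. ip (usec v z) (usec w y))"
    by (rule H.ip_sum_right[OF fin w vz])
  also have "ip (usec v z) (H.ksec (anch u y)) = (if v \<subseteq> u then \<gamma> v * ku k v y z else 0)"
    unfolding H.ip_ksec[OF X vz] using X assms(2) z by (simp add: usec_def ku_anch_left)
  also have "(\<Sum>w\<in>Pow u - {u}. ip (usec v z) (usec w y)) =
      (\<Sum>w\<in>Pow u - {u}. if w = v then \<gamma> v * ku k v y z else 0)"
  proof (rule sum.cong[OF refl])
    fix w assume "w \<in> Pow u - {u}"
    then have "w \<subset> u" by blast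
    from psubset.IH[OF this] show "ip (usec v z) (usec w y) = (if w = v then \<gamma> v * ku k v y z else 0)"
      by auto
  qed
  also have "\<dots> = (if v \<in> Pow u - {u} then \<gamma> v * ku k v y z else 0)"
    using fin by (simp add: sum.delta)
  finally show ?case by auto
qed

section \<open>Tensor powers of finite combinations of sections\<close>

text \<open>Built from \<open>k\<close> itself, while the sections of \<open>F1\<close> carry the
  factor \<open>\<gamma> {1}\<close>. One function can thus be the factor for every
  \<open>u\<close>, whatever its weight.\<close>

definition kcomb :: "real set \<Rightarrow> (real \<Rightarrow> real) \<Rightarrow> real \<Rightarrow> real" where
  "kcomb Y b t = (\<Sum>y\<in>Y. b y * k t y)"

text \<open>A scaled tensor power of \<open>kcomb Y b\<close>. With the representer of the
  univariate integral for the kernel \<open>k\<close> in its place, this would be the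
  \<open>u\<close>-component of the representer of \<open>Iint \<rho>\<close>.\<close>

definition ucomb :: "real set \<Rightarrow> (real \<Rightarrow> real) \<Rightarrow> nat set \<Rightarrow> (nat \<Rightarrow> real) \<Rightarrow> real" where
  "ucomb Y b u = (\<lambda>x. if x \<in> X then \<gamma> u * (\<Prod>j\<in>u. kcomb Y b (x j)) else 0)"

lemma anch_PiE: "Y \<subseteq> D \<Longrightarrow> \<eta> \<in> PiE u (\<lambda>_. Y) \<Longrightarrow> anch u \<eta> j \<in> D"
  by (rule anch_in_D) auto

text \<open>Elements of \<open>PiE\<close> are \<open>undefined\<close> outside \<open>u\<close>;
  \<open>anch u\<close> replaces that value by \<open>a\<close>, so that the results on points with
  coordinates in \<open>D\<close> apply.\<close>

lemma prod_kcomb: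
  assumes "finite u" "finite Y"
  shows "(\<Prod>j\<in>u. kcomb Y b (x j)) =
      (\<Sum>\<eta>\<in>PiE u (\<lambda>_. Y). (\<Prod>j\<in>u. b (\<eta> j)) * ku k u x (anch u \<eta>))"
  unfolding kcomb_def using assms
  by (subst prod_sum_PiE) (auto simp: prod.distrib ku_def anch_def intro!: sum.cong prod.cong)

lemma ucomb_expand:
  assumes "finite u" "finite Y"
  shows "ucomb Y b u = (\<lambda>x. \<Sum>\<eta>\<in>PiE u (\<lambda>_. Y). (\<Prod>j\<in>u. b (\<eta> j)) * usec u (anch u \<eta>) x)"
  unfolding ucomb_def usec_def prod_kcomb[OF assms]
  by (rule ext) (simp add: sum_distrib_left mult_ac)

lemma ucomb_mem:
  assumes "finite u" "finite Y" "Y \<subseteq> D"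
  shows "ucomb Y b u \<in> F"
  unfolding ucomb_expand[OF assms(1,2)] using assms
  by (intro H.sum_mem H.scale_mem usec_mem finite_PiE anch_PiE) simp_all

lemma ip_ucomb_usec:
  assumes "finite u" "finite w" "finite Y" "Y \<subseteq> D" "\<And>j. y j \<in> D"
  shows "ip (ucomb Y b u) (usec w y) = (if u = w then \<gamma> u * (\<Prod>j\<in>u. kcomb Y b (y j)) else 0)"
proof -
  have fin: "finite (PiE u (\<lambda>_. Y))" using assms by (intro finite_PiE) auto
  have mem: "usec u (anch u \<eta>) \<in> F" if "\<eta> \<in> PiE u (\<lambda>_. Y)" for \<eta>
    by (rule usec_mem[OF assms(1) anch_PiE[OF assms(4) that]])
  have wy: "usec w y \<in> F" by (rule usec_mem[OF assms(2,5)])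
  have "ip (ucomb Y b u) (usec w y) =
      (\<Sum>\<eta>\<in>PiE u (\<lambda>_. Y). (\<Prod>j\<in>u. b (\<eta> j)) * ip (usec u (anch u \<eta>)) (usec w y))"
    unfolding ucomb_expand[OF assms(1,3)]
    by (subst H.ip_sum_left[OF fin H.scale_mem[OF mem] wy], assumption)
      (rule sum.cong[OF refl], rule H.ip_scale_left[OF mem wy])
  also have "\<dots> = (\<Sum>\<eta>\<in>PiE u (\<lambda>_. Y). (\<Prod>j\<in>u. b (\<eta> j)) *
      (if w = u then \<gamma> w * ku k w y (anch u \<eta>) else 0))"
    using ip_usec_usec[OF assms(2,1,5) anch_PiE[OF assms(4)]] by (intro sum.cong refl) simp
  finally show ?thesis
    using prod_kcomb[OF assms(1,3), of b y]
    by (cases "u = w") (simp_all add: sum_distrib_left mult_ac)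
qed

text \<open>\<open>\<Sum>y\<in>Y. b y * kcomb Y b y\<close> is the squared norm of
  \<open>kcomb Y b\<close> for the kernel \<open>k\<close>, and squared norms multiply under tensor
  products. Scaling contributes \<open>\<gamma> u\<close> twice, and the norm for the kernel
  \<open>\<gamma> u * ku k u\<close> takes one of the two away.\<close>

lemma ip_ucomb_ucomb:
  assumes "finite u" "finite w" "finite Y" "Y \<subseteq> D"
  shows "ip (ucomb Y b u) (ucomb Y b w) =
    (if u = w then \<gamma> u * (\<Sum>y\<in>Y. b y * kcomb Y b y) ^ card u else 0)"
proof -
  have fin: "finite (PiE w (\<lambda>_. Y))" using assms by (intro finite_PiE) auto
  have mem: "usec w (anch w \<eta>) \<in> F" if "\<eta> \<in> PiE w (\<lambda>_. Y)" for \<eta>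
    by (rule usec_mem[OF assms(2) anch_PiE[OF assms(4) that]])
  have uy: "ucomb Y b u \<in> F" by (rule ucomb_mem[OF assms(1,3,4)])
  have "ip (ucomb Y b u) (ucomb Y b w) =
      (\<Sum>\<eta>\<in>PiE w (\<lambda>_. Y). (\<Prod>j\<in>w. b (\<eta> j)) * ip (ucomb Y b u) (usec w (anch w \<eta>)))"
    unfolding ucomb_expand[OF assms(2,3), of b]
    by (subst H.ip_sum_right[OF fin H.scale_mem[OF mem] uy], assumption)
      (rule sum.cong[OF refl], rule H.ip_scale_right[OF mem uy])
  also have "\<dots> = (\<Sum>\<eta>\<in>PiE w (\<lambda>_. Y). (\<Prod>j\<in>w. b (\<eta> j)) *
      (if u = w then \<gamma> u * (\<Prod>j\<in>u. kcomb Y b (\<eta> j)) else 0))"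
  proof (intro sum.cong refl arg_cong2[where f = times])
    fix \<eta> assume \<eta>: "\<eta> \<in> PiE w (\<lambda>_. Y)"
    have "(\<Prod>j\<in>w. kcomb Y b (anch w \<eta> j)) = (\<Prod>j\<in>w. kcomb Y b (\<eta> j))"
      by (intro prod.cong) (simp_all add: anch_def)
    then show "ip (ucomb Y b u) (usec w (anch w \<eta>)) =
        (if u = w then \<gamma> u * (\<Prod>j\<in>u. kcomb Y b (\<eta> j)) else 0)"
      using ip_ucomb_usec[OF assms anch_PiE[OF assms(4) \<eta>]] by simp
  qed
  also have "\<dots> = (if u = w then \<gamma> u * (\<Sum>\<eta>\<in>PiE w (\<lambda>_. Y). \<Prod>j\<in>w. b (\<eta> j) * kcomb Y b (\<eta> j)) else 0)"
    by (simp add: sum_distrib_left prod.distrib mult_ac)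
  also have "(\<Sum>\<eta>\<in>PiE w (\<lambda>_. Y). \<Prod>j\<in>w. b (\<eta> j) * kcomb Y b (\<eta> j)) =
      (\<Prod>j\<in>w. \<Sum>y\<in>Y. b y * kcomb Y b y)"
    using assms by (subst prod_sum_PiE) auto
  finally show ?thesis by simp
qed

lemma ucomb_sum_mem:
  assumes "finite T" "\<And>u. u \<in> T \<Longrightarrow> finite u" "finite Y" "Y \<subseteq> D"
  shows "(\<lambda>x. \<Sum>u\<in>T. ucomb Y b u x) \<in> F"
  using ucomb_mem[OF assms(2-4)] by (intro H.sum_mem assms(1))

lemma ip_ucomb_sum:
  assumes "finite T" "\<And>u. u \<in> T \<Longrightarrow> finite u" "finite Y" "Y \<subseteq> D"
  shows "ip (\<lambda>x. \<Sum>u\<in>T. ucomb Y b u x) (\<lambda>x. \<Sum>u\<in>T. ucomb Y b u x) =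
    (\<Sum>u\<in>T. \<gamma> u * (\<Sum>y\<in>Y. b y * kcomb Y b y) ^ card u)"
proof -
  note mem = ucomb_mem[OF assms(2-4)]
  have "ip (\<lambda>x. \<Sum>u\<in>T. ucomb Y b u x) (\<lambda>x. \<Sum>u\<in>T. ucomb Y b u x) =
      (\<Sum>u\<in>T. \<Sum>w\<in>T. ip (ucomb Y b u) (ucomb Y b w))"
    by (subst H.ip_sum_left[OF assms(1) mem ucomb_sum_mem[OF assms]], assumption)
      (rule sum.cong[OF refl], rule H.ip_sum_right[OF assms(1) mem mem])
  also have "\<dots> = (\<Sum>u\<in>T. \<Sum>w\<in>T. if u = w then \<gamma> u * (\<Sum>y\<in>Y. b y * kcomb Y b y) ^ card u else 0)"
    by (intro sum.cong refl ip_ucomb_ucomb assms)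
  finally show ?thesis using assms(1) by simp
qed

lemma ucomb_vanishes:
  assumes "x \<in> Xva D a v" "finite u" "\<not> u \<subseteq> v" "Y \<subseteq> D"
  shows "ucomb Y b u x = 0"
proof -
  obtain j where j: "j \<in> u" "j \<notin> v" using assms(3) by blast
  then have "x j = a" using assms(1) by (auto simp: Xva_def)
  then have "kcomb Y b (x j) = 0"
    using assms(4) k_anchor_left by (auto simp: kcomb_def intro!: sum.neutral)
  then show ?thesis using j assms(2) by (auto simp: ucomb_def)
qed

section \<open>Univariate integration and its representer\<close>

sublocale R: prob_space \<rho> by (rule rho_prob)

lemma space_rho: "space \<rho> = D"
  using sets_eq_imp_space_eq[OF rho_sets] by (simp add: space_restrict_space)

lemma k_section_measurable: "y \<in> D \<Longrightarrow> (\<lambda>x. k x y) \<in> borel_measurable \<rho>"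
  using measurable_compose[OF measurable_Pair2'[of y \<rho> \<rho>] k_meas]
  by (simp add: space_rho)

lemma ksec_measurable: "y \<in> D \<Longrightarrow> H1.ksec y \<in> borel_measurable \<rho>"
  by (subst measurable_cong[where g = "\<lambda>x. \<gamma> {1} * k x y"])
    (auto simp: space_rho H1.ksec_def intro!: borel_measurable_times k_section_measurable)

text \<open>The kernel axioms say nothing about measurability. It is inherited from the sections,
  since norm convergence implies pointwise convergence and \<open>kspan\<close> is dense.\<close>

lemma F1_measurable:
  assumes "g \<in> F1"
  shows "g \<in> borel_measurable \<rho>"
proof -
  obtain S where S: "\<forall>n. S n \<in> H1.kspan"
    and lim: "(\<lambda>n. ip1 (\<lambda>x. S n x - g x) (\<lambda>x. S n x - g x)) \<longlonglongrightarrow> 0"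
    by (rule H1.kspan_dense[OF assms])
  have SF: "S n \<in> F1" for n by (rule subsetD[OF H1.kspan_subset spec[OF S]])
  have "S n \<in> borel_measurable \<rho>" for n
  proof -
    obtain Y b where Y: "Y \<subseteq> D" "S n = (\<lambda>x. \<Sum>y\<in>Y. b y * H1.ksec y x)"
      by (rule H1.kspanE[OF spec[OF S]])
    show ?thesis
      unfolding Y(2) using Y(1)
      by (intro borel_measurable_sum borel_measurable_times measurable_const ksec_measurable) auto
  qed
  then show ?thesis
    by (rule borel_measurable_LIMSEQ_real[rotated]) (rule H1.pointwise_tendsto[OF SF assms lim])
qed

lemma F1_square_integrable:
  assumes "g \<in> F1"
  shows "integrable \<rho> (\<lambda>x. (g x)\<^sup>2)"
proof (rule Bochner_Integration.integrable_bound)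
  show "integrable \<rho> (\<lambda>x. ip1 g g * (\<gamma> {1} * k x x))"
    using M_finite by simp
  show "(\<lambda>x. (g x)\<^sup>2) \<in> borel_measurable \<rho>"
    by (intro borel_measurable_power F1_measurable assms)
  show "AE x in \<rho>. norm ((g x)\<^sup>2) \<le> norm (ip1 g g * (\<gamma> {1} * k x x))"
    using H1.eval_bound[OF assms] by (intro AE_I2) (fastforce simp: space_rho intro: order_trans abs_ge_self)
qed

lemma F1_integrable: "g \<in> F1 \<Longrightarrow> integrable \<rho> g"
  by (rule R.square_integrable_imp_integrable[OF F1_measurable F1_square_integrable])

text \<open>The square of a mean is at most the mean of the square, and the latter is bounded by
  \<open>eval_bound\<close>. This is the boundedness that \<open>riesz\<close> asks for.\<close>

lemma F1_integral_bound:
  assumes "g \<in> F1"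
  shows "(\<integral>x. g x \<partial>\<rho>)\<^sup>2 \<le> \<gamma> {1} * Mk k \<rho> * ip1 g g"
proof -
  have "(\<integral>x. g x \<partial>\<rho>)\<^sup>2 \<le> (\<integral>x. (g x)\<^sup>2 \<partial>\<rho>)"
    using R.variance_positive[of g]
      R.variance_eq[OF F1_integrable[OF assms] F1_square_integrable[OF assms]] by simp
  also have "\<dots> \<le> (\<integral>x. ip1 g g * (\<gamma> {1} * k x x) \<partial>\<rho>)"
    using M_finite H1.eval_bound[OF assms]
    by (intro integral_mono F1_square_integrable assms) (auto simp: space_rho)
  also have "\<dots> = \<gamma> {1} * Mk k \<rho> * ip1 g g" by (simp add: Mk_def)
  finally show ?thesis .
qed

lemma Mk_nonneg: "0 \<le> Mk k \<rho>"
  unfolding Mk_def by (intro integral_nonneg_AE AE_I2) (simp add: space_rho k_nonneg)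

text \<open>Testing \<open>h\<close> against sections shows
  \<open>h y = \<gamma> {1} * (\<integral>x. k x y \<partial>\<rho>)\<close>. Integrating once more
  gives \<open>ip1 h h\<close>, which is how \<open>C0\<close> enters the error bound.\<close>

lemma integral_representer:
  obtains h where "h \<in> F1" "\<forall>g\<in>F1. ip1 h g = (\<integral>x. g x \<partial>\<rho>)" "ip1 h h = \<gamma> {1} * C0 k \<rho>"
proof -
  have add: "(\<integral>x. f x + g x \<partial>\<rho>) = (\<integral>x. f x \<partial>\<rho>) + (\<integral>x. g x \<partial>\<rho>)"
    if "f \<in> F1" "g \<in> F1" for f g
    using that by (intro Bochner_Integration.integral_add F1_integrable)
  have scale: "(\<integral>x. c * f x \<partial>\<rho>) = c * (\<integral>x. f x \<partial>\<rho>)" for c and f :: "real \<Rightarrow> real"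
    by simp
  have nn: "0 \<le> \<gamma> {1} * Mk k \<rho>" using gamma1 Mk_nonneg by simp
  obtain h where h: "h \<in> F1" and "\<exists>S. (\<forall>n. S n \<in> F1) \<and> (\<forall>v\<in>F1. ip1 h v = (\<integral>x. v x \<partial>\<rho>)) \<and>
      (\<lambda>n. ip1 (\<lambda>x. S n x - h x) (\<lambda>x. S n x - h x)) \<longlonglongrightarrow> 0"
    by (rule bexE[OF H1.riesz[of F1 "\<lambda>g. \<integral>x. g x \<partial>\<rho>", OF order_refl H1.zero_mem H1.add_mem
          H1.scale_mem add scale nn F1_integral_bound]])
  then have rep: "ip1 h g = (\<integral>x. g x \<partial>\<rho>)" if "g \<in> F1" for g
    using that by blast
  have "h y = \<gamma> {1} * (\<integral>x. k x y \<partial>\<rho>)" if y: "y \<in> D" for y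
  proof -
    have "h y = (\<integral>x. H1.ksec y x \<partial>\<rho>)"
      using rep[OF H1.ksec_mem[OF y]] H1.ip_ksec[OF y h] by simp
    also have "\<dots> = (\<integral>x. \<gamma> {1} * k x y \<partial>\<rho>)"
      by (intro Bochner_Integration.integral_cong) (auto simp: H1.ksec_def space_rho)
    finally show ?thesis by simp
  qed
  then have "(\<integral>y. h y \<partial>\<rho>) = (\<integral>y. \<gamma> {1} * (\<integral>x. k x y \<partial>\<rho>) \<partial>\<rho>)"
    by (intro Bochner_Integration.integral_cong) (auto simp: space_rho)
  also have "\<dots> = \<gamma> {1} * C0 k \<rho>" by (simp add: C0_def)
  finally show thesis using that[OF h] rep h by simp
qed

text \<open>The bound on the integral is applied to the representer itself. Consequence: the
  \<open>ghat\<close> weights inherit summability from the weights with \<open>Mk\<close>.\<close>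

lemma C0_le_Mk: "C0 k \<rho> \<le> Mk k \<rho>"
proof -
  obtain h where h: "h \<in> F1" "\<forall>g\<in>F1. ip1 h g = (\<integral>x. g x \<partial>\<rho>)" "ip1 h h = \<gamma> {1} * C0 k \<rho>"
    by (rule integral_representer)
  have "(\<gamma> {1} * C0 k \<rho>) * (\<gamma> {1} * C0 k \<rho>) \<le> (\<gamma> {1} * C0 k \<rho>) * (\<gamma> {1} * Mk k \<rho>)"
    using F1_integral_bound[OF h(1)] h(1,2) h(3) by (simp add: power2_eq_square mult_ac)
  then show ?thesis using gamma1 C0_pos by (simp add: mult_le_cancel_left_pos)
qed

lemma kcomb_kspan:
  assumes "finite Y" "Y \<subseteq> D"
  shows "(\<lambda>x. \<Sum>y\<in>Y. b y * H1.ksec y x) \<in> F1"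
    "x \<in> D \<Longrightarrow> (\<Sum>y\<in>Y. b y * H1.ksec y x) = \<gamma> {1} * kcomb Y b x"
proof -
  show "(\<lambda>x. \<Sum>y\<in>Y. b y * H1.ksec y x) \<in> F1"
    by (rule subsetD[OF H1.kspan_subset H1.kspanI[OF assms]])
  show "x \<in> D \<Longrightarrow> (\<Sum>y\<in>Y. b y * H1.ksec y x) = \<gamma> {1} * kcomb Y b x"
    unfolding H1.ksec_def kcomb_def by (simp add: sum_distrib_left mult_ac)
qed

lemma integral_kcomb:
  assumes "finite Y" "Y \<subseteq> D"
  shows "(\<integral>x. (\<Sum>y\<in>Y. b y * H1.ksec y x) \<partial>\<rho>) = \<gamma> {1} * (\<integral>x. kcomb Y b x \<partial>\<rho>)"
proof -
  have "(\<integral>x. (\<Sum>y\<in>Y. b y * H1.ksec y x) \<partial>\<rho>) = (\<integral>x. \<gamma> {1} * kcomb Y b x \<partial>\<rho>)"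
    by (intro Bochner_Integration.integral_cong refl kcomb_kspan(2)[OF assms]) (simp add: space_rho)
  then show ?thesis by simp
qed

lemma kcomb_integrable:
  assumes "finite Y" "Y \<subseteq> D"
  shows "integrable \<rho> (kcomb Y b)"
proof -
  have "integrable \<rho> (\<lambda>x. \<gamma> {1} * kcomb Y b x)"
    using F1_integrable[OF kcomb_kspan(1)[OF assms, of b]]
    by (rule Bochner_Integration.integrable_cong[THEN iffD1, OF refl, rotated])
      (simp add: space_rho kcomb_kspan(2)[OF assms])
  then show ?thesis using gamma1 by simp
qed

lemma ip1_kcomb:
  assumes "finite Y" "Y \<subseteq> D"
  shows "ip1 (\<lambda>x. \<Sum>y\<in>Y. b y * H1.ksec y x) (\<lambda>x. \<Sum>y\<in>Y. b y * H1.ksec y x) =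
    \<gamma> {1} * (\<Sum>y\<in>Y. b y * kcomb Y b y)"
proof -
  define g where "g = (\<lambda>x. \<Sum>y\<in>Y. b y * H1.ksec y x)"
  have g: "g \<in> F1" unfolding g_def by (rule kcomb_kspan(1)[OF assms])
  have ky: "H1.ksec y \<in> F1" if "y \<in> Y" for y using that assms by (intro H1.ksec_mem) auto
  have "ip1 g g = ip1 g (\<lambda>x. \<Sum>y\<in>Y. b y * H1.ksec y x)" by (simp only: g_def)
  also have "\<dots> = (\<Sum>y\<in>Y. ip1 g (\<lambda>x. b y * H1.ksec y x))"
    by (rule H1.ip_sum_right[OF assms(1) H1.scale_mem[OF ky] g])
  also have "\<dots> = (\<Sum>y\<in>Y. b y * (\<gamma> {1} * kcomb Y b y))"
  proof (rule sum.cong[OF refl])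
    fix y assume y: "y \<in> Y"
    have "ip1 g (\<lambda>x. b y * H1.ksec y x) = b y * g y"
      using y assms(2) by (simp only: H1.ip_scale_right[OF ky[OF y] g] H1.ip_ksec[OF subsetD g])
    also have "g y = \<gamma> {1} * kcomb Y b y"
      using y assms(2) unfolding g_def by (intro kcomb_kspan(2)[OF assms]) auto
    finally show "ip1 g (\<lambda>x. b y * H1.ksec y x) = b y * (\<gamma> {1} * kcomb Y b y)" .
  qed
  finally show ?thesis by (simp add: g_def sum_distrib_left mult_ac)
qed

text \<open>Both limits agree because the representer has its integral equal to its squared norm. In
  \<open>F1\<close> both quantities carry the factor \<open>\<gamma> {1}\<close>, which is divided
  out.\<close>

lemma kcomb_approximation:
  obtains Y b where "\<forall>n::nat. finite (Y n) \<and> Y n \<subseteq> D"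
    "(\<lambda>n. \<integral>x. kcomb (Y n) (b n) x \<partial>\<rho>) \<longlonglongrightarrow> C0 k \<rho>"
    "(\<lambda>n. \<Sum>y\<in>Y n. b n y * kcomb (Y n) (b n) y) \<longlonglongrightarrow> C0 k \<rho>"
proof -
  obtain h where h: "h \<in> F1" "\<forall>g\<in>F1. ip1 h g = (\<integral>x. g x \<partial>\<rho>)" "ip1 h h = \<gamma> {1} * C0 k \<rho>"
    by (rule integral_representer)
  obtain S where S: "\<forall>n. S n \<in> H1.kspan"
    and lim: "(\<lambda>n. ip1 (\<lambda>x. S n x - h x) (\<lambda>x. S n x - h x)) \<longlonglongrightarrow> 0"
    by (rule H1.kspan_dense[OF h(1)])
  have SF: "S n \<in> F1" for n by (rule subsetD[OF H1.kspan_subset spec[OF S]])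
  have "\<forall>n. \<exists>Y b. finite Y \<and> Y \<subseteq> D \<and> S n = (\<lambda>x. \<Sum>y\<in>Y. b y * H1.ksec y x)"
    using S unfolding H1.kspan_def by simp
  then obtain Y where "\<forall>n. \<exists>b. finite (Y n) \<and> Y n \<subseteq> D \<and> S n = (\<lambda>x. \<Sum>y\<in>Y n. b y * H1.ksec y x)"
    unfolding choice_iff by (rule exE)
  then obtain b where "\<forall>n. finite (Y n) \<and> Y n \<subseteq> D \<and> S n = (\<lambda>x. \<Sum>y\<in>Y n. b n y * H1.ksec y x)"
    unfolding choice_iff by (rule exE)
  then have Y: "finite (Y n)" "Y n \<subseteq> D" and SY: "S n = (\<lambda>x. \<Sum>y\<in>Y n. b n y * H1.ksec y x)" for n
    by simp_all
  have 1: "(\<lambda>n. \<integral>x. S n x \<partial>\<rho>) \<longlonglongrightarrow> \<gamma> {1} * C0 k \<rho>"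
    using H1.ip_tendsto[OF SF h(1,1) lim] by (simp add: h(2,3) SF H1.ip_commute[OF SF h(1)])
  have 2: "(\<lambda>n. ip1 (S n) (S n)) \<longlonglongrightarrow> \<gamma> {1} * C0 k \<rho>"
    using H1.ip_self_tendsto[OF SF h(1) lim] by (simp add: h(3))
  have 3: "(\<lambda>n. \<integral>x. kcomb (Y n) (b n) x \<partial>\<rho>) \<longlonglongrightarrow> C0 k \<rho>"
    using tendsto_divide[OF 1 tendsto_const[of "\<gamma> {1}"]] gamma1
    by (simp add: SY integral_kcomb Y)
  have 4: "(\<lambda>n. \<Sum>y\<in>Y n. b n y * kcomb (Y n) (b n) y) \<longlonglongrightarrow> C0 k \<rho>"
    using tendsto_divide[OF 2 tendsto_const[of "\<gamma> {1}"]] gamma1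
    by (simp add: SY ip1_kcomb Y)
  show thesis by (rule that[OF _ 3 4]) (simp add: Y)
qed

section \<open>Integration over the infinite product and the domain \<open>X\<close>\<close>

abbreviation \<Omega> :: "(nat \<Rightarrow> real) measure" where "\<Omega> \<equiv> PiM UNIV (\<lambda>_. \<rho>)"

sublocale \<Omega>: prob_space \<Omega>
  by (rule prob_space_PiM) (rule rho_prob)

lemma coordinate_measurable: "(\<lambda>x. x j) \<in> measurable \<Omega> \<rho>"
  by (rule measurable_component_singleton) simp

lemma indep_coordinates: "\<Omega>.indep_vars (\<lambda>_. \<rho>) (\<lambda>j x. x j) UNIV"
proof -
  have "distr \<Omega> \<rho> (\<lambda>x. x j) = \<rho>" for j
    using distr_PiM_component[of UNIV "\<lambda>_. \<rho>" j] rho_prob by simp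
  moreover have "distr \<Omega> \<Omega> (\<lambda>x. x) = \<Omega>" by (rule distr_id)
  ultimately show ?thesis
    by (subst \<Omega>.indep_vars_iff_distr_eq_PiM')
      (simp_all add: coordinate_measurable restrict_UNIV)
qed

lemma indep_coordinate_functions:
  "g \<in> measurable \<rho> N \<Longrightarrow> \<Omega>.indep_vars (\<lambda>_. N) (\<lambda>j x. g (x j)) u"
  using \<Omega>.indep_vars_compose2[OF \<Omega>.indep_vars_subset[OF indep_coordinates subset_UNIV],
      of u "\<lambda>_. g" "\<lambda>_. N"] by simp

lemma integral_coordinate:
  fixes q :: "real \<Rightarrow> real"
  assumes "integrable \<rho> q"
  shows "integrable \<Omega> (\<lambda>x. q (x j))" "(\<integral>x. q (x j) \<partial>\<Omega>) = (\<integral>t. q t \<partial>\<rho>)"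
proof -
  have d: "distr \<Omega> \<rho> (\<lambda>x. x j) = \<rho>"
    using distr_PiM_component[of UNIV "\<lambda>_. \<rho>" j] rho_prob by simp
  show "integrable \<Omega> (\<lambda>x. q (x j))"
    using integrable_distr[OF coordinate_measurable[of j], of q] assms d by simp
  show "(\<integral>x. q (x j) \<partial>\<Omega>) = (\<integral>t. q t \<partial>\<rho>)"
    using integral_distr[OF coordinate_measurable[of j], of q] borel_measurable_integrable[OF assms] d
    by simp
qed

lemma integral_coordinate_product:
  fixes q :: "real \<Rightarrow> real"
  assumes "finite u" "integrable \<rho> q"
  shows "integrable \<Omega> (\<lambda>x. \<Prod>j\<in>u. q (x j))"
    "(\<integral>x. (\<Prod>j\<in>u. q (x j)) \<partial>\<Omega>) = (\<integral>t. q t \<partial>\<rho>) ^ card u"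
proof -
  have i: "\<Omega>.indep_vars (\<lambda>_. borel) (\<lambda>j x. q (x j)) u"
    by (intro indep_coordinate_functions borel_measurable_integrable assms(2))
  show "integrable \<Omega> (\<lambda>x. \<Prod>j\<in>u. q (x j))"
    by (rule \<Omega>.indep_vars_integrable[OF assms(1) i integral_coordinate(1)[OF assms(2)]])
  show "(\<integral>x. (\<Prod>j\<in>u. q (x j)) \<partial>\<Omega>) = (\<integral>t. q t \<partial>\<rho>) ^ card u"
    using \<Omega>.indep_vars_lebesgue_integral[OF assms(1) i integral_coordinate(1)[OF assms(2)]]
    by (simp add: integral_coordinate(2)[OF assms(2)])
qed

text \<open>Turns the unordered sum that defines \<open>X\<close> into a series with values in
  \<open>ennreal\<close>, from which measurability of \<open>X\<close> and its full measure can be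
  read off.\<close>

definition enum :: "nat \<Rightarrow> nat set" where
  "enum = from_nat_into {u. finite u}"

lemma enum_bij: "bij_betw enum UNIV {u. finite u}"
  unfolding enum_def
proof (rule bij_betw_from_nat_into)
  show "countable {u :: nat set. finite u}" by (rule countable_Collect_finite)
  have "inj (\<lambda>n::nat. {n})" by (auto intro: injI)
  then have "infinite (range (\<lambda>n::nat. {n}))" by (rule range_inj_infinite)
  then show "infinite {u :: nat set. finite u}"
    by (rule infinite_super[rotated]) auto
qed

lemma enum_finite: "finite (enum n)"
  using bij_betwE[OF enum_bij] by auto

lemma space_Omega: "x \<in> space \<Omega> \<longleftrightarrow> (\<forall>j. x j \<in> D)"
  by (auto simp: space_PiM space_rho)

lemma ku_diag_nonneg: "x \<in> space \<Omega> \<Longrightarrow> 0 \<le> \<gamma> u * ku k u x x"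
  using gamma_nonneg by (auto simp: ku_def space_Omega intro!: mult_nonneg_nonneg prod_nonneg k_nonneg)

lemma Xdom_iff:
  assumes "x \<in> space \<Omega>"
  shows "x \<in> X \<longleftrightarrow> (\<Sum>n. ennreal (\<gamma> (enum n) * ku k (enum n) x x)) \<noteq> top"
proof -
  have "(\<lambda>u. \<gamma> u * ku k u x x) summable_on {u. finite u} \<longleftrightarrow>
      (\<lambda>n. \<gamma> (enum n) * ku k (enum n) x x) summable_on UNIV"
    by (rule summable_on_reindex_bij_betw[OF enum_bij, symmetric])
  also have "\<dots> \<longleftrightarrow> summable (\<lambda>n. \<gamma> (enum n) * ku k (enum n) x x)"
    by (rule summable_on_UNIV_nonneg_real_iff) (rule ku_diag_nonneg[OF assms])
  also have "\<dots> \<longleftrightarrow> (\<Sum>n. ennreal (\<gamma> (enum n) * ku k (enum n) x x)) \<noteq> top"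
    using ennreal_suminf_neq_top[OF _ ku_diag_nonneg[OF assms]]
      summable_suminf_not_top[OF ku_diag_nonneg[OF assms]] by (rule iffI)
  finally show ?thesis using assms by (simp add: Xdom_def space_Omega)
qed

lemma ku_diag_measurable: "(\<lambda>x. \<gamma> u * ku k u x x) \<in> borel_measurable \<Omega>"
  unfolding ku_def
  by (intro borel_measurable_times borel_measurable_prod measurable_const
      measurable_compose[OF coordinate_measurable, of "\<lambda>t. k t t" borel]
      borel_measurable_integrable M_finite) simp

lemma ku_series_measurable:
  "(\<lambda>x. \<Sum>n. ennreal (\<gamma> (enum n) * ku k (enum n) x x)) \<in> borel_measurable \<Omega>"
  by (intro borel_measurable_suminf_order measurable_compose[OF ku_diag_measurable measurable_ennreal])

text \<open>By independence of the coordinates the series defining \<open>X\<close> has expectation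
  equal to the sum of \<open>\<gamma> u * Mk k \<rho> ^ card u\<close>, which is finite; hence the
  series is finite almost everywhere.\<close>

lemma AE_Xdom: "AE x in \<Omega>. x \<in> X"
proof -
  have expectation: "(\<integral>\<^sup>+ x. ennreal (\<gamma> u * ku k u x x) \<partial>\<Omega>) = ennreal (\<gamma> u * Mk k \<rho> ^ card u)"
    if u: "finite u" for u
  proof -
    note p = integral_coordinate_product[OF u M_finite]
    have int: "integrable \<Omega> (\<lambda>x. \<gamma> u * ku k u x x)" using p(1) by (simp add: ku_def)
    have eq: "(\<integral>x. \<gamma> u * ku k u x x \<partial>\<Omega>) = \<gamma> u * Mk k \<rho> ^ card u"
      using p(2) by (simp add: ku_def Mk_def)
    show ?thesis
      using nn_integral_eq_integral[OF int AE_I2[OF ku_diag_nonneg]] by (simp only: eq)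
  qed
  have nn: "0 \<le> \<gamma> (enum n) * Mk k \<rho> ^ card (enum n)" for n
    using gamma_nonneg Mk_nonneg by simp
  have "(\<lambda>n. \<gamma> (enum n) * Mk k \<rho> ^ card (enum n)) summable_on UNIV"
    using summable_on_reindex_bij_betw[OF enum_bij, of "\<lambda>u. \<gamma> u * Mk k \<rho> ^ card u"]
      gamma_summable by simp
  then have summ: "summable (\<lambda>n. \<gamma> (enum n) * Mk k \<rho> ^ card (enum n))"
    by (rule summable_on_imp_summable)
  have "(\<integral>\<^sup>+ x. (\<Sum>n. ennreal (\<gamma> (enum n) * ku k (enum n) x x)) \<partial>\<Omega>) =
      (\<Sum>n. ennreal (\<gamma> (enum n) * Mk k \<rho> ^ card (enum n)))"
    by (subst nn_integral_suminf)
      (auto simp: expectation enum_finite intro: measurable_compose[OF ku_diag_measurable measurable_ennreal])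
  also have "\<dots> \<noteq> \<infinity>" using ennreal_suminf_neq_top[OF summ nn] by simp
  finally have "AE x in \<Omega>. (\<Sum>n. ennreal (\<gamma> (enum n) * ku k (enum n) x x)) \<noteq> \<infinity>"
    by (rule nn_integral_PInf_AE[OF ku_series_measurable])
  then show ?thesis using Xdom_iff by (auto elim!: AE_mp)
qed

lemma Xdom_sets: "{x \<in> space \<Omega>. x \<in> X} \<in> sets \<Omega>"
proof -
  have "{x \<in> space \<Omega>. x \<in> X} =
      {x \<in> space \<Omega>. (\<Sum>n. ennreal (\<gamma> (enum n) * ku k (enum n) x x)) \<noteq> top}"
    using Xdom_iff by blast
  also have "\<dots> \<in> sets \<Omega>"
    using ku_series_measurable by measurable
  finally show ?thesis .
qed

text \<open>The cut-off outside \<open>X\<close> changes the product only on a null set, and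
  \<open>Xdom_sets\<close> keeps the modified function measurable.\<close>

lemma integral_Xdom_product:
  fixes q :: "real \<Rightarrow> real"
  assumes "finite u" "integrable \<rho> q"
  shows "integrable \<Omega> (\<lambda>x. if x \<in> X then \<Prod>j\<in>u. q (x j) else 0)"
    "(\<integral>x. (if x \<in> X then \<Prod>j\<in>u. q (x j) else 0) \<partial>\<Omega>) = (\<integral>t. q t \<partial>\<rho>) ^ card u"
proof -
  note p = integral_coordinate_product[OF assms]
  have m: "(\<lambda>x. if x \<in> X then \<Prod>j\<in>u. q (x j) else 0) \<in> borel_measurable \<Omega>"
    by (rule measurable_If[OF borel_measurable_integrable[OF p(1)] measurable_const Xdom_sets]) simp
  have ae: "AE x in \<Omega>. (\<Prod>j\<in>u. q (x j)) = (if x \<in> X then \<Prod>j\<in>u. q (x j) else 0)"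
    using AE_Xdom by eventually_elim simp
  show "integrable \<Omega> (\<lambda>x. if x \<in> X then \<Prod>j\<in>u. q (x j) else 0)"
    by (rule integrable_cong_AE_imp[OF p(1) m]) (use ae in eventually_elim, simp)
  show "(\<integral>x. (if x \<in> X then \<Prod>j\<in>u. q (x j) else 0) \<partial>\<Omega>) = (\<integral>t. q t \<partial>\<rho>) ^ card u"
    using integral_cong_AE[OF borel_measurable_integrable[OF p(1)] m ae] p(2) by simp
qed

lemma Iint_ucomb_sum:
  assumes "finite T" "\<And>u. u \<in> T \<Longrightarrow> finite u" "finite Y" "Y \<subseteq> D"
  shows "Iint \<rho> (\<lambda>x. c * (\<Sum>u\<in>T. ucomb Y b u x)) =
    c * (\<Sum>u\<in>T. \<gamma> u * (\<integral>t. kcomb Y b t \<partial>\<rho>) ^ card u)"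
proof -
  have u: "ucomb Y b u = (\<lambda>x. \<gamma> u * (if x \<in> X then \<Prod>j\<in>u. kcomb Y b (x j) else 0))" for u
    by (auto simp: ucomb_def)
  have int: "integrable \<Omega> (ucomb Y b u)" if "u \<in> T" for u
    unfolding u using integral_Xdom_product(1)[OF assms(2)[OF that] kcomb_integrable[OF assms(3,4)]]
    by (rule integrable_mult_right)
  have "(\<integral>x. ucomb Y b u x \<partial>\<Omega>) = \<gamma> u * (\<integral>t. kcomb Y b t \<partial>\<rho>) ^ card u" if "u \<in> T" for u
    unfolding u using integral_Xdom_product(2)[OF assms(2)[OF that] kcomb_integrable[OF assms(3,4)], of b]
    by simp
  then show ?thesis unfolding Iint_def using int by (simp add: Bochner_Integration.integral_sum)
qed

section \<open>Embedding of the univariate space through coordinate 1\<close>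

definition lift1 :: "(real \<Rightarrow> real) \<Rightarrow> (nat \<Rightarrow> real) \<Rightarrow> real" where
  "lift1 g = (\<lambda>x. if x \<in> X then g (x 1) else 0)"

lemma Iint_lift1:
  assumes "g \<in> F1"
  shows "Iint \<rho> (lift1 g) = (\<integral>t. g t \<partial>\<rho>)"
  using integral_Xdom_product(2)[of "{1}", OF _ F1_integrable[OF assms]]
  by (simp add: Iint_def lift1_def cong: if_cong)

text \<open>The isometric embedding is clear on finite combinations of kernel sections and
  extends to \<open>F1\<close> by completeness of \<open>F\<close>.\<close>

lemma lift1_mem:
  assumes g: "g \<in> F1"
  shows "lift1 g \<in> F" "ip (lift1 g) (lift1 g) = ip1 g g"
proof -
  have fin1: "finite {1 :: nat}" by simp
  have span: "lift1 v \<in> F \<and> ip (lift1 v) (lift1 v) = ip1 v v" if v: "v \<in> H1.kspan" for v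
  proof -
    obtain Y b where Y: "finite Y" "Y \<subseteq> D" "v = (\<lambda>x. \<Sum>y\<in>Y. b y * H1.ksec y x)"
      by (rule H1.kspanE[OF v])
    \<comment> \<open>The factor \<open>\<gamma> {1}\<close> carried by the sections of
      \<open>F1\<close> is the one in \<open>ucomb\<close> for \<open>u = {1}\<close>; the isometry
      is then a comparison of \<open>ip_ucomb_ucomb\<close> with \<open>ip1_kcomb\<close>.\<close>
    have "lift1 v = ucomb Y b {1}"
      unfolding lift1_def ucomb_def Y(3)
      by (rule ext) (simp add: kcomb_kspan(2)[OF Y(1,2)] Xdom_in_D)
    then show ?thesis
      using ucomb_mem[OF fin1 Y(1,2)] ip_ucomb_ucomb[OF fin1 fin1 Y(1,2), of b]
        ip1_kcomb[OF Y(1,2), of b] by (simp add: Y(3))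
  qed
  obtain S where S: "\<forall>n. S n \<in> H1.kspan"
    and lim: "(\<lambda>n. ip1 (\<lambda>x. S n x - g x) (\<lambda>x. S n x - g x)) \<longlonglongrightarrow> 0"
    by (rule H1.kspan_dense[OF g])
  have SF: "S n \<in> F1" for n by (rule subsetD[OF H1.kspan_subset spec[OF S]])
  have LF: "lift1 (S n) \<in> F" for n using span[OF spec[OF S]] by (rule conjunct1)
  have diff: "ip (\<lambda>x. lift1 (S m) x - lift1 (S n) x) (\<lambda>x. lift1 (S m) x - lift1 (S n) x) =
      ip1 (\<lambda>x. S m x - S n x) (\<lambda>x. S m x - S n x)" for m n
  proof -
    have "(\<lambda>x. S m x - S n x) \<in> H1.kspan" by (intro H1.kspan_diff spec[OF S])
    from conjunct2[OF span[OF this]] show ?thesis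
      by (simp add: lift1_def if_distrib cong: if_cong)
  qed
  have cauchy: "\<exists>N. \<forall>m\<ge>N. \<forall>n\<ge>N. ip (\<lambda>x. lift1 (S m) x - lift1 (S n) x)
      (\<lambda>x. lift1 (S m) x - lift1 (S n) x) < e" if "e > 0" for e
    unfolding diff by (rule H1.convergent_imp_cauchy[OF SF g lim that])
  obtain G where G: "G \<in> F"
    and lim': "(\<lambda>n. ip (\<lambda>x. lift1 (S n) x - G x) (\<lambda>x. lift1 (S n) x - G x)) \<longlonglongrightarrow> 0"
    by (rule H.complete[of "\<lambda>n. lift1 (S n)", OF LF cauchy])
  have "G x = lift1 g x" for x
  proof (rule LIMSEQ_unique)
    show "(\<lambda>n. lift1 (S n) x) \<longlonglongrightarrow> G x" by (rule H.pointwise_tendsto[OF LF G lim'])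
    show "(\<lambda>n. lift1 (S n) x) \<longlonglongrightarrow> lift1 g x"
      using H1.pointwise_tendsto[OF SF g lim] by (simp add: lift1_def)
  qed
  then have Gg: "G = lift1 g" by (rule ext)
  show "lift1 g \<in> F" using G by (simp only: Gg)
  have "(\<lambda>n. ip (lift1 (S n)) (lift1 (S n))) \<longlonglongrightarrow> ip G G"
    by (rule H.ip_self_tendsto[OF LF G lim'])
  moreover have "(\<lambda>n. ip (lift1 (S n)) (lift1 (S n))) = (\<lambda>n. ip1 (S n) (S n))"
    using span S by simp
  ultimately show "ip (lift1 g) (lift1 g) = ip1 g g"
    using LIMSEQ_unique[OF _ H1.ip_self_tendsto[OF SF g lim]] by (simp add: Gg)
qed

end

section \<open>Algorithms that observe only zeros\<close>

lemma length_ra_vals: "length (ra_vals A f \<omega> i) = i"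
  by (induction i) simp_all

lemma ra_card_enatD:
  "ra_card A f \<omega> = enat n \<Longrightarrow> (LEAST i. ra_stop A \<omega> (ra_vals A f \<omega> i)) = n"
  by (auto simp: ra_card_def split: if_splits)

lemma ra_vals_zero:
  assumes "\<And>i. i < n \<Longrightarrow> f (ra_point A f \<omega> i) = 0" "i \<le> n"
  shows "ra_vals A f \<omega> i = replicate i 0"
  using assms(2)
proof (induction i)
  case (Suc i)
  then have "f (ra_point A f \<omega> i) = 0" by (intro assms(1)) simp
  then show ?case using Suc by (simp add: ra_point_def replicate_append_same)
qed simp

text \<open>An algorithm that only sees zeros cannot tell \<open>f\<close> from its negative \<open>f'\<close>.\<close>

lemma wce2_ge_of_vanishing:
  assumes valid: "ra_valid A F"
    and card: "\<And>f \<omega>. f \<in> F \<Longrightarrow> \<omega> \<in> space (ra_space A) \<Longrightarrow>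
        ra_card A f \<omega> = enat n \<and> (\<forall>i<n. ra_point A f \<omega> i \<in> P i)"
    and f: "f \<in> F" "f \<in> B" "\<And>i x. i < n \<Longrightarrow> x \<in> P i \<Longrightarrow> f x = 0"
    and f': "f' \<in> F" "f' \<in> B" "\<And>i x. i < n \<Longrightarrow> x \<in> P i \<Longrightarrow> f' x = 0"
    and I: "I f' = - I f"
    and err: "wce2 A I B \<le> ennreal e" and e: "0 \<le> e"
  shows "(I f)\<^sup>2 \<le> e"
proof -
  interpret prob_space "ra_space A" using valid by (simp add: ra_valid_def)
  \<comment> \<open>The right side does not mention \<open>g\<close>, so the answers on
    \<open>f\<close> and on \<open>f'\<close> coincide for every \<open>\<omega>\<close>.\<close>
  have out: "ra_out A g \<omega> = ra_res A \<omega> (replicate n 0)"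
    if "g \<in> F" "\<And>i x. i < n \<Longrightarrow> x \<in> P i \<Longrightarrow> g x = 0" "\<omega> \<in> space (ra_space A)" for g \<omega>
  proof -
    have "ra_vals A g \<omega> n = replicate n 0"
      using card[OF that(1,3)] that(2) by (intro ra_vals_zero[of n]) auto
    then show ?thesis
      using ra_card_enatD[OF conjunct1[OF card[OF that(1,3)]]] by (simp add: ra_out_def)
  qed
  have [measurable]: "ra_out A f \<in> borel_measurable (ra_space A)"
    using valid f(1) by (simp add: ra_valid_def)
  have 1: "(\<integral>\<^sup>+ \<omega>. ennreal ((I f - ra_out A f \<omega>)\<^sup>2) \<partial>ra_space A) \<le> ennreal e"
    using SUP_upper[OF f(2), of "\<lambda>f. \<integral>\<^sup>+ \<omega>. ennreal ((I f - ra_out A f \<omega>)\<^sup>2) \<partial>ra_space A"] err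
    unfolding wce2_def by (rule order_trans)
  have "(\<integral>\<^sup>+ \<omega>. ennreal ((- I f - ra_out A f \<omega>)\<^sup>2) \<partial>ra_space A) =
      (\<integral>\<^sup>+ \<omega>. ennreal ((I f' - ra_out A f' \<omega>)\<^sup>2) \<partial>ra_space A)"
    by (intro nn_integral_cong) (simp add: I out f f')
  also have "\<dots> \<le> ennreal e"
    using SUP_upper[OF f'(2), of "\<lambda>f. \<integral>\<^sup>+ \<omega>. ennreal ((I f - ra_out A f \<omega>)\<^sup>2) \<partial>ra_space A"] err
    unfolding wce2_def by (rule order_trans)
  finally have 2: "(\<integral>\<^sup>+ \<omega>. ennreal ((- I f - ra_out A f \<omega>)\<^sup>2) \<partial>ra_space A) \<le> ennreal e" .
  have "ennreal (2 * (I f)\<^sup>2) = (\<integral>\<^sup>+ \<omega>. ennreal (2 * (I f)\<^sup>2) \<partial>ra_space A)"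
    by (simp add: emeasure_space_1)
  also have "\<dots> \<le> (\<integral>\<^sup>+ \<omega>. ennreal ((I f - ra_out A f \<omega>)\<^sup>2) + ennreal ((- I f - ra_out A f \<omega>)\<^sup>2) \<partial>ra_space A)"
  proof (intro nn_integral_mono)
    fix \<omega>
    \<comment> \<open>The two sides differ by twice the squared output.\<close>
    have "2 * (I f)\<^sup>2 \<le> (I f - ra_out A f \<omega>)\<^sup>2 + (- I f - ra_out A f \<omega>)\<^sup>2"
      using zero_le_power2[of "ra_out A f \<omega>"] by (simp add: power2_eq_square algebra_simps)
    then show "ennreal (2 * (I f)\<^sup>2) \<le>
        ennreal ((I f - ra_out A f \<omega>)\<^sup>2) + ennreal ((- I f - ra_out A f \<omega>)\<^sup>2)"
      by (simp add: ennreal_plus[symmetric] ennreal_leI del: ennreal_plus)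
  qed
  also have "\<dots> = (\<integral>\<^sup>+ \<omega>. ennreal ((I f - ra_out A f \<omega>)\<^sup>2) \<partial>ra_space A) +
      (\<integral>\<^sup>+ \<omega>. ennreal ((- I f - ra_out A f \<omega>)\<^sup>2) \<partial>ra_space A)"
    by (intro nn_integral_add) measurable
  also have "\<dots> \<le> ennreal e + ennreal e" by (intro add_mono 1 2)
  also have "\<dots> = ennreal (2 * e)" using e by (simp add: ennreal_plus[symmetric] del: ennreal_plus)
  finally show ?thesis using e by (simp add: ennreal_le_iff)
qed

section \<open>Lower error bounds for the restricted class\<close>

context weighted_kernel
begin

abbreviation B :: "((nat \<Rightarrow> real) \<Rightarrow> real) set" where "B \<equiv> unit_ball F ip"

text \<open>The approximants \<open>f m\<close> have integral \<open>M m\<close> and squared norm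
  \<open>N m\<close>, both tending to the claimed sum \<open>G\<close>. Each of them, once
  normalised, gives \<open>(M m)^2 \<le> \<epsilon>^2 * N m\<close>; in the limit
  \<open>G^2 \<le> \<epsilon>^2 * G\<close>, and the case \<open>G = 0\<close> is split off to allow
  division.\<close>

lemma ghat_sum_le_error:
  fixes A :: "('w, nat \<Rightarrow> real) ralg"
  assumes valid: "ra_valid A F"
    and card: "\<And>f \<omega>. f \<in> F \<Longrightarrow> \<omega> \<in> space (ra_space A) \<Longrightarrow>
        ra_card A f \<omega> = enat n \<and> (\<forall>i<n. ra_point A f \<omega> i \<in> Xva D a (v i))"
    and err: "wce2 A (Iint \<rho>) B \<le> ennreal (\<epsilon>\<^sup>2)"
    and T: "finite T" "\<And>u. u \<in> T \<Longrightarrow> finite u" "\<And>u i. u \<in> T \<Longrightarrow> i < n \<Longrightarrow> \<not> u \<subseteq> v i"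
  shows "(\<Sum>u\<in>T. ghat \<gamma> (C0 k \<rho>) u) \<le> \<epsilon>\<^sup>2"
proof -
  define G where "G = (\<Sum>u\<in>T. ghat \<gamma> (C0 k \<rho>) u)"
  have "0 \<le> G"
    unfolding G_def ghat_def using gamma_nonneg C0_pos by (intro sum_nonneg mult_nonneg_nonneg) auto
  then consider "G = 0" | "G > 0" by linarith
  then have "G \<le> \<epsilon>\<^sup>2"
  proof cases
    case 2
    obtain Y b where "\<forall>n::nat. finite (Y n) \<and> Y n \<subseteq> D"
      and m_lim: "(\<lambda>n. \<integral>x. kcomb (Y n) (b n) x \<partial>\<rho>) \<longlonglongrightarrow> C0 k \<rho>"
      and q_lim: "(\<lambda>n. \<Sum>y\<in>Y n. b n y * kcomb (Y n) (b n) y) \<longlonglongrightarrow> C0 k \<rho>"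
      by (rule kcomb_approximation)
    then have Y: "finite (Y n)" "Y n \<subseteq> D" for n by auto
    define f where "f n = (\<lambda>x. \<Sum>u\<in>T. ucomb (Y n) (b n) u x)" for n
    define M where "M n = (\<Sum>u\<in>T. \<gamma> u * (\<integral>x. kcomb (Y n) (b n) x \<partial>\<rho>) ^ card u)" for n
    define N where "N n = (\<Sum>u\<in>T. \<gamma> u * (\<Sum>y\<in>Y n. b n y * kcomb (Y n) (b n) y) ^ card u)" for n
    have M_lim: "M \<longlonglongrightarrow> G"
      unfolding M_def G_def ghat_def by (intro tendsto_intros m_lim)
    have N_lim: "N \<longlonglongrightarrow> G"
      unfolding N_def G_def ghat_def by (intro tendsto_intros q_lim)
    have fF: "f n \<in> F" for n unfolding f_def by (rule ucomb_sum_mem[OF T(1,2) Y])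
    have fN: "ip (f n) (f n) = N n" for n unfolding f_def N_def by (rule ip_ucomb_sum[OF T(1,2) Y])
    have f_vanish: "f m x = 0" if "i < n" "x \<in> Xva D a (v i)" for m i x
      unfolding f_def using that T by (intro sum.neutral ballI ucomb_vanishes[of x "v i"] Y) auto
    have key: "(M m)\<^sup>2 \<le> \<epsilon>\<^sup>2 * N m" if N: "N m > 0" for m
    proof -
      define c where "c = 1 / sqrt (N m)"
      have c2: "c\<^sup>2 * N m = 1" using N by (simp add: c_def power_divide)
      have cF: "(\<lambda>x. d * f m x) \<in> F" for d by (rule H.scale_mem[OF fF])
      have cip: "ip (\<lambda>x. d * f m x) (\<lambda>x. d * f m x) = d\<^sup>2 * N m" for d
        unfolding H.ip_scale_left[OF fF cF] H.ip_scale_right[OF fF fF] fN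
        by (simp add: power2_eq_square)
      have cB: "(\<lambda>x. d * f m x) \<in> B" if "d\<^sup>2 = c\<^sup>2" for d
        using cF[of d] cip[of d] c2 that by (simp add: unit_ball_def)
      have cI: "Iint \<rho> (\<lambda>x. d * f m x) = d * M m" for d
        unfolding f_def M_def by (rule Iint_ucomb_sum[OF T(1,2) Y])
      have "(Iint \<rho> (\<lambda>x. c * f m x))\<^sup>2 \<le> \<epsilon>\<^sup>2"
      proof (rule wce2_ge_of_vanishing[where I = "Iint \<rho>" and f = "\<lambda>x. c * f m x"
            and f' = "\<lambda>x. (- c) * f m x" and B = B, OF valid card])
        show "Iint \<rho> (\<lambda>x. (- c) * f m x) = - Iint \<rho> (\<lambda>x. c * f m x)"
          unfolding cI by simp
      qed (use cF[of c] cF[of "-c"] cB[of c] cB[of "-c"] err f_vanish in simp_all)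
      then have "c\<^sup>2 * (M m)\<^sup>2 \<le> \<epsilon>\<^sup>2" by (simp add: cI power_mult_distrib)
      then have "c\<^sup>2 * (M m)\<^sup>2 * N m \<le> \<epsilon>\<^sup>2 * N m" using N by (intro mult_right_mono) auto
      moreover have "c\<^sup>2 * (M m)\<^sup>2 * N m = (c\<^sup>2 * N m) * (M m)\<^sup>2" by simp
      ultimately show ?thesis by (simp only: c2 mult_1)
    qed
    have "G\<^sup>2 \<le> \<epsilon>\<^sup>2 * G"
    proof (rule tendsto_le[OF sequentially_bot])
      show "(\<lambda>m. (M m)\<^sup>2) \<longlonglongrightarrow> G\<^sup>2" by (intro tendsto_intros M_lim)
      show "(\<lambda>m. \<epsilon>\<^sup>2 * N m) \<longlonglongrightarrow> \<epsilon>\<^sup>2 * G" by (intro tendsto_intros N_lim)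
      show "\<forall>\<^sub>F m in sequentially. (M m)\<^sup>2 \<le> \<epsilon>\<^sup>2 * N m"
        using order_tendstoD(1)[OF N_lim 2] by (rule eventually_mono) (rule key)
    qed
    then show ?thesis using 2 by (simp add: power2_eq_square[of G])
  qed simp
  then show ?thesis by (simp add: G_def)
qed

lemma zero_in_B: "(\<lambda>x. 0) \<in> B"
  by (simp add: unit_ball_def H.zero_mem H.ip_zero_left)

text \<open>In the restricted class the expected cost is the same for all inputs, so evaluating it
  at the zero function, which is in the unit ball, turns the worst-case cost into the sum of the
  prices. The strict bound allows for an infimum that is not attained.\<close>

lemma comp_res_lessD:
  assumes "comp_res TYPE('w) cst D a F B (Iint \<rho>) \<epsilon> < c"
  obtains A :: "('w, nat \<Rightarrow> real) ralg" and n v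
  where "ra_valid A F" "\<forall>i<n. finite (v i)"
    "\<forall>f\<in>F. \<forall>\<omega>\<in>space (ra_space A). ra_card A f \<omega> = enat n \<and> (\<forall>i<n. ra_point A f \<omega> i \<in> Xva D a (v i))"
    "wce2 A (Iint \<rho>) B \<le> ennreal (\<epsilon>\<^sup>2)" "(\<Sum>i<n. cst (card (v i))) < c"
proof -
  obtain A :: "('w, nat \<Rightarrow> real) ralg" where A: "in_Ares cst D a F A"
    "wce2 A (Iint \<rho>) B \<le> ennreal (\<epsilon>\<^sup>2)" "cost_unr (cost_a cst D a) A B < c"
    using assms unfolding comp_res_def INF_less_iff by blast
  obtain n and v :: "nat \<Rightarrow> nat set" where v: "\<forall>i<n. finite (v i)"
    "\<forall>f\<in>F. \<forall>\<omega>\<in>space (ra_space A). ra_card A f \<omega> = enat n \<and> (\<forall>i<n. ra_point A f \<omega> i \<in> Xva D a (v i))"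
    "\<forall>f\<in>F. ra_exp_cost (cost_a cst D a) A f = (\<Sum>i<n. cst (card (v i)))"
    using A(1) unfolding in_Ares_def by (elim conjE exE)
  have "(\<Sum>i<n. cst (card (v i))) = ra_exp_cost (cost_a cst D a) A (\<lambda>x. 0)"
    using v(3) H.zero_mem by simp
  also have "\<dots> \<le> cost_unr (cost_a cst D a) A B"
    unfolding cost_unr_def by (rule SUP_upper[OF zero_in_B])
  also note A(3)
  finally have "(\<Sum>i<n. cst (card (v i))) < c" .
  moreover have "ra_valid A F" using A(1) by (simp add: in_Ares_def)
  ultimately show thesis using that v(1,2) A(2) by blast
qed

lemma comp_res_ghat_sum:
  assumes "comp_res TYPE('w) cst D a F B (Iint \<rho>) \<epsilon> < c"
  obtains n and v :: "nat \<Rightarrow> nat set" where "\<forall>i<n. finite (v i)" "(\<Sum>i<n. cst (card (v i))) < c"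
    "\<forall>T. finite T \<and> (\<forall>u\<in>T. finite u \<and> (\<forall>i<n. \<not> u \<subseteq> v i)) \<longrightarrow> (\<Sum>u\<in>T. ghat \<gamma> (C0 k \<rho>) u) \<le> \<epsilon>\<^sup>2"
proof -
  obtain A :: "('w, nat \<Rightarrow> real) ralg" and n v
  where *: "ra_valid A F" "\<forall>i<n. finite (v i)"
    "\<forall>f\<in>F. \<forall>\<omega>\<in>space (ra_space A). ra_card A f \<omega> = enat n \<and> (\<forall>i<n. ra_point A f \<omega> i \<in> Xva D a (v i))"
    "wce2 A (Iint \<rho>) B \<le> ennreal (\<epsilon>\<^sup>2)" "(\<Sum>i<n. cst (card (v i))) < c"
    by (rule comp_res_lessD[OF assms])
  have "(\<Sum>u\<in>T. ghat \<gamma> (C0 k \<rho>) u) \<le> \<epsilon>\<^sup>2"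
    if "finite T \<and> (\<forall>u\<in>T. finite u \<and> (\<forall>i<n. \<not> u \<subseteq> v i))" for T
    by (rule ghat_sum_le_error[OF *(1) bspec[OF bspec[OF *(3)]] *(4)]) (use that in auto)
  then show thesis using that[OF *(2,5)] by blast
qed

section \<open>Reduction to univariate integration\<close>

text \<open>Simulates \<open>A\<close> on \<open>lift1 g\<close>, which only looks at coordinate 1.
  The stopping rule counts to \<open>n\<close> instead of being copied, so that the number of
  evaluations is \<open>n\<close> for every \<open>g\<close> and every
  \<open>\<omega>\<close>.\<close>

definition univariate :: "nat \<Rightarrow> ('w, nat \<Rightarrow> real) ralg \<Rightarrow> ('w, real) ralg" where
  "univariate n A = \<lparr>ra_space = ra_space A, ra_pt = (\<lambda>i \<omega> ys. ra_pt A i \<omega> ys 1),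
     ra_stop = (\<lambda>\<omega> ys. length ys = n), ra_res = ra_res A\<rparr>"

lemma ra_vals_univariate:
  assumes "\<And>i. i < n \<Longrightarrow> ra_point A (lift1 g) \<omega> i \<in> X" "i \<le> n"
  shows "ra_vals (univariate n A) g \<omega> i = ra_vals A (lift1 g) \<omega> i"
  using assms(2)
proof (induction i)
  case (Suc i)
  then show ?case using assms(1)[of i] by (simp add: univariate_def lift1_def ra_point_def)
qed simp

lemma ra_card_univariate: "ra_card (univariate n A) g \<omega> = enat n"
proof -
  have "ra_stop (univariate n A) \<omega> (ra_vals (univariate n A) g \<omega> i) \<longleftrightarrow> i = n" for i
    using length_ra_vals[of "univariate n A" g \<omega> i] by (simp add: univariate_def)
  then show ?thesis by (auto simp: ra_card_def intro!: Least_equality)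
qed

text \<open>Every price is at least 1, so an algorithm of cost below \<open>c\<close> makes
  \<open>n < c\<close> evaluations. Its univariate version pays \<open>n * \<kappa> \<le> N\<close>
  and, by the isometry \<open>lift1\<close>, has no larger error.\<close>

lemma emin1_sq_le:
  fixes N :: nat
  assumes comp: "comp_res TYPE('w) cst D a F B (Iint \<rho>) \<epsilon> < ennreal c"
    and cst: "\<forall>\<nu>. 1 \<le> cst \<nu>" "cst 1 = ennreal \<kappa>" "0 \<le> \<kappa>" "\<kappa> * c \<le> real N"
  shows "emin1_sq TYPE('w) cst D F1 (unit_ball F1 ip1) (\<lambda>g. \<integral>x. g x \<partial>\<rho>) N \<le> ennreal (\<epsilon>\<^sup>2)"
proof -
  obtain A :: "('w, nat \<Rightarrow> real) ralg" and n v
  where A: "ra_valid A F" "\<forall>i<n. finite (v i)"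
    "\<forall>f\<in>F. \<forall>\<omega>\<in>space (ra_space A). ra_card A f \<omega> = enat n \<and> (\<forall>i<n. ra_point A f \<omega> i \<in> Xva D a (v i))"
    "wce2 A (Iint \<rho>) B \<le> ennreal (\<epsilon>\<^sup>2)" "(\<Sum>i<n. cst (card (v i))) < ennreal c"
    by (rule comp_res_lessD[OF comp])
  define U where "U = univariate n A"
  have space_U: "ra_space U = ra_space A" by (simp add: U_def univariate_def)
  interpret prob_space "ra_space A" using A(1) by (simp add: ra_valid_def)
  \<comment> \<open>At points of \<open>X\<close> the cut-off in \<open>lift1\<close> is invisible,
    so both algorithms see the same values.\<close>
  have in_X: "ra_point A (lift1 g) \<omega> i \<in> X"
    if "g \<in> F1" "\<omega> \<in> space (ra_space A)" "i < n" for g \<omega> i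
    using A(2,3) lift1_mem(1)[OF that(1)] that(2,3) by (blast intro: Xva_subset_Xdom)
  have vals: "ra_vals U g \<omega> i = ra_vals A (lift1 g) \<omega> i"
    if "g \<in> F1" "\<omega> \<in> space (ra_space A)" "i \<le> n" for g \<omega> i
    unfolding U_def using in_X that by (intro ra_vals_univariate) auto
  have card_U: "ra_card U g \<omega> = enat n" for g \<omega> by (simp add: U_def ra_card_univariate)
  have out: "ra_out U g \<omega> = ra_out A (lift1 g) \<omega>"
    if g: "g \<in> F1" and \<omega>: "\<omega> \<in> space (ra_space A)" for g \<omega>
  proof -
    have "ra_card A (lift1 g) \<omega> = enat n" using A(3) lift1_mem(1)[OF g] \<omega> by blast
    then show ?thesis
      using vals[OF g \<omega> order_refl]
      by (simp add: ra_out_def ra_card_enatD[OF card_U] ra_card_enatD) (simp add: U_def univariate_def)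
  qed
  have valid: "ra_valid U F1"
    unfolding ra_valid_def space_U
  proof (intro conjI ballI)
    fix g assume g: "g \<in> F1"
    have A': "ra_out A (lift1 g) \<in> borel_measurable (ra_space A)"
      "integrable (ra_space A) (\<lambda>\<omega>. (ra_out A (lift1 g) \<omega>)\<^sup>2)"
      using A(1) lift1_mem(1)[OF g] by (simp_all add: ra_valid_def)
    show "ra_out U g \<in> borel_measurable (ra_space A)"
      using A'(1) by (rule measurable_cong[THEN iffD1, rotated]) (simp add: out[OF g])
    show "integrable (ra_space A) (\<lambda>\<omega>. (ra_out U g \<omega>)\<^sup>2)"
      using A'(2) by (rule Bochner_Integration.integrable_cong[THEN iffD1, OF refl, rotated])
        (simp add: out[OF g])
  qed (rule prob_space_axioms)
  have points: "ra_point U g \<omega> i \<in> D"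
    if "g \<in> F1" "\<omega> \<in> space (ra_space A)" "enat i < ra_card U g \<omega>" for g \<omega> i
  proof -
    have i: "i < n" using that(3) by (simp add: card_U)
    have "ra_point U g \<omega> i = ra_point A (lift1 g) \<omega> i 1"
      using vals[OF that(1,2), of i] i by (simp add: ra_point_def) (simp add: U_def univariate_def)
    then show ?thesis using Xdom_in_D[OF in_X[OF that(1,2) i]] by simp
  qed
  have "ennreal (real n) = (\<Sum>i<n. 1)" by (simp add: ennreal_of_nat_eq_real_of_nat)
  also have "\<dots> \<le> (\<Sum>i<n. cst (card (v i)))" using cst(1) by (intro sum_mono) auto
  also note A(5)
  finally have n: "real n < c" by (simp add: ennreal_less_iff)
  have cost: "cost_unr (\<lambda>_. cst 1) U (unit_ball F1 ip1) \<le> of_nat N"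
    unfolding cost_unr_def
  proof (rule SUP_least)
    fix g
    have "ra_cost (\<lambda>_. cst 1) U g \<omega> = of_nat n * cst 1" for \<omega>
      unfolding ra_cost_def card_U by (subst suminf_finite[of "{..<n}"]) simp_all
    then have "ra_exp_cost (\<lambda>_. cst 1) U g = of_nat n * cst 1"
      by (simp add: ra_exp_cost_def space_U emeasure_space_1)
    also have "\<dots> = ennreal (real n * \<kappa>)"
      using cst(2,3) by (simp add: ennreal_of_nat_eq_real_of_nat ennreal_mult)
    also have "\<dots> \<le> ennreal (real N)"
    proof (rule ennreal_leI)
      have "real n * \<kappa> \<le> c * \<kappa>" using n cst(3) by (intro mult_right_mono) auto
      then show "real n * \<kappa> \<le> real N" using cst(4) by (simp add: mult.commute)
    qed
    finally show "ra_exp_cost (\<lambda>_. cst 1) U g \<le> of_nat N"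
      by (simp add: ennreal_of_nat_eq_real_of_nat)
  qed
  have "wce2 U (\<lambda>g. \<integral>x. g x \<partial>\<rho>) (unit_ball F1 ip1) \<le> wce2 A (Iint \<rho>) B"
    unfolding wce2_def
  proof (rule SUP_mono)
    fix g assume "g \<in> unit_ball F1 ip1"
    then have g: "g \<in> F1" "ip1 g g \<le> 1" by (simp_all add: unit_ball_def)
    have "lift1 g \<in> B" using lift1_mem[OF g(1)] g(2) by (simp add: unit_ball_def)
    moreover have "(\<integral>\<^sup>+ \<omega>. ennreal (((\<integral>x. g x \<partial>\<rho>) - ra_out U g \<omega>)\<^sup>2) \<partial>ra_space U) =
        (\<integral>\<^sup>+ \<omega>. ennreal ((Iint \<rho> (lift1 g) - ra_out A (lift1 g) \<omega>)\<^sup>2) \<partial>ra_space A)"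
      unfolding space_U Iint_lift1[OF g(1)] by (intro nn_integral_cong) (simp add: out[OF g(1)])
    ultimately show "\<exists>f\<in>B. (\<integral>\<^sup>+ \<omega>. ennreal (((\<integral>x. g x \<partial>\<rho>) - ra_out U g \<omega>)\<^sup>2) \<partial>ra_space U) \<le>
        (\<integral>\<^sup>+ \<omega>. ennreal ((Iint \<rho> f - ra_out A f \<omega>)\<^sup>2) \<partial>ra_space A)"
      by (intro bexI[of _ "lift1 g"]) simp_all
  qed
  also note A(4)
  finally have err: "wce2 U (\<lambda>g. \<integral>x. g x \<partial>\<rho>) (unit_ball F1 ip1) \<le> ennreal (\<epsilon>\<^sup>2)" .
  have "emin1_sq TYPE('w) cst D F1 (unit_ball F1 ip1) (\<lambda>g. \<integral>x. g x \<partial>\<rho>) N \<le>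
      wce2 U (\<lambda>g. \<integral>x. g x \<partial>\<rho>) (unit_ball F1 ip1)"
    unfolding emin1_sq_def
    by (rule INF_lower) (use valid points cost in \<open>simp add: space_U\<close>)
  then show ?thesis using err by (rule order_trans)
qed

end

section \<open>How many sets a given budget can cover\<close>

lemma cost_power_bound:
  assumes ge1: "\<forall>\<nu>. 1 \<le> cst \<nu>" and s: "0 < s"
    and growth: "\<exists>c>0. eventually (\<lambda>\<nu>. ennreal (c * real \<nu> powr s) \<le> cst \<nu>) sequentially"
  obtains c where "c > 0" "\<forall>\<nu>. ennreal (c * real \<nu> powr s) \<le> cst \<nu>"
proof -
  obtain c N where c: "c > 0" and N: "\<And>\<nu>. \<nu> \<ge> N \<Longrightarrow> ennreal (c * real \<nu> powr s) \<le> cst \<nu>"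
    using growth unfolding eventually_sequentially by blast
  \<comment> \<open>Below the threshold this makes \<open>d * real \<nu> powr s \<le> 1\<close>,
    which every price exceeds or equals; \<open>Suc N\<close> keeps \<open>d\<close> positive when
    \<open>N = 0\<close>.\<close>
  define d where "d = min c (1 / real (Suc N) powr s)"
  have "ennreal (d * real \<nu> powr s) \<le> cst \<nu>" for \<nu>
  proof (cases "\<nu> \<ge> N")
    case True
    have "d * real \<nu> powr s \<le> c * real \<nu> powr s" by (intro mult_right_mono) (auto simp: d_def)
    then show ?thesis using N[OF True] by (meson ennreal_leI order_trans)
  next
    case False
    have "d * real \<nu> powr s \<le> 1 / real (Suc N) powr s * real (Suc N) powr s"
      using False s by (intro mult_mono powr_mono2) (auto simp: d_def)
    then have "ennreal (d * real \<nu> powr s) \<le> 1" by (simp add: ennreal_le_1)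
    then show ?thesis using ge1 order_trans by blast
  qed
  moreover have "d > 0" using c by (simp add: d_def)
  ultimately show thesis using that by blast
qed

text \<open>Write \<open>x powr r\<close> as \<open>x * x powr (r - 1)\<close> and bound the second
  factor by the one for the whole sum.\<close>

lemma sum_powr_le_powr_sum:
  fixes x :: "'i \<Rightarrow> real"
  assumes "finite I" "\<And>i. i \<in> I \<Longrightarrow> 0 \<le> x i" "1 \<le> r"
  shows "(\<Sum>i\<in>I. x i powr r) \<le> (\<Sum>i\<in>I. x i) powr r"
proof -
  have nn: "0 \<le> (\<Sum>i\<in>I. x i)" using assms by (intro sum_nonneg)
  have split: "y powr r = y * y powr (r - 1)" if "0 \<le> y" for y :: real
    using that assms(3) powr_add[of y 1 "r - 1"] by (cases "y = 0") simp_all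
  have "(\<Sum>i\<in>I. x i powr r) \<le> (\<Sum>i\<in>I. x i * (\<Sum>i\<in>I. x i) powr (r - 1))"
  proof (rule sum_mono)
    fix i assume i: "i \<in> I"
    have "x i \<le> (\<Sum>i\<in>I. x i)" using assms i by (intro member_le_sum) auto
    then show "x i powr r \<le> x i * (\<Sum>i\<in>I. x i) powr (r - 1)"
      unfolding split[OF assms(2)[OF i]] using assms i by (intro mult_left_mono powr_mono2) auto
  qed
  also have "\<dots> = (\<Sum>i\<in>I. x i) powr r"
    by (simp add: split[OF nn] sum_distrib_right)
  finally show ?thesis .
qed

text \<open>The budget bounds the sum of \<open>card (v i) powr s\<close>. A single set covers at
  most \<open>Ct * (card (v i) powr s) powr r\<close> members with \<open>r = max 1 (t / s)\<close>,
  and for \<open>r \<ge> 1\<close> these powers are superadditive. The value 1 is reached when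
  \<open>t \<le> s\<close>, where large sets bring no gain.\<close>

lemma card_covered_le:
  fixes v :: "nat \<Rightarrow> nat set"
  assumes t: "\<forall>v. finite v \<longrightarrow> real (card {u \<in> S. u \<subseteq> v}) \<le> Ct * real (card v) powr t"
    and Ct: "Ct > 0" and s: "s > 0" and c1: "c1 > 0"
    and cost: "\<forall>\<nu>. ennreal (c1 * real \<nu> powr s) \<le> cst \<nu>"
    and v: "\<forall>i<n. finite (v i)" and c: "(\<Sum>i<n. cst (card (v i))) < ennreal c"
  shows "finite {u \<in> S. \<exists>i<n. u \<subseteq> v i}"
    "real (card {u \<in> S. \<exists>i<n. u \<subseteq> v i}) \<le> Ct * (c / c1) powr max 1 (t / s)"
proof -
  define r where "r = max 1 (t / s)"
  have un: "{u \<in> S. \<exists>i<n. u \<subseteq> v i} = (\<Union>i\<in>{..<n}. {u \<in> S. u \<subseteq> v i})" by blast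
  show fin: "finite {u \<in> S. \<exists>i<n. u \<subseteq> v i}"
    unfolding un using v by (intro finite_UN_I) (auto intro: finite_subset[of _ "Pow _"])
  have "ennreal (\<Sum>i<n. c1 * real (card (v i)) powr s) = (\<Sum>i<n. ennreal (c1 * real (card (v i)) powr s))"
    using c1 by (intro sum_ennreal[symmetric]) simp
  also have "\<dots> \<le> (\<Sum>i<n. cst (card (v i)))" using cost by (intro sum_mono) simp
  also note c
  finally have "(\<Sum>i<n. c1 * real (card (v i)) powr s) < c"
    using c1 by (subst (asm) ennreal_less_iff) (auto intro: sum_nonneg)
  then have sum_le: "(\<Sum>i<n. real (card (v i)) powr s) \<le> c / c1"
    using c1 by (simp add: sum_distrib_left[symmetric] field_simps)
  have t_le: "t \<le> s * r" using s by (simp add: r_def field_simps max_def)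
  have "real (card {u \<in> S. \<exists>i<n. u \<subseteq> v i}) \<le> (\<Sum>i<n. real (card {u \<in> S. u \<subseteq> v i}))"
    unfolding un using card_UN_le[of "{..<n}" "\<lambda>i. {u \<in> S. u \<subseteq> v i}"]
    by (simp flip: of_nat_sum)
  also have "\<dots> \<le> (\<Sum>i<n. Ct * (real (card (v i)) powr s) powr r)"
  proof (rule sum_mono)
    fix i assume "i \<in> {..<n}"
    then have "real (card {u \<in> S. u \<subseteq> v i}) \<le> Ct * real (card (v i)) powr t" using t v by simp
    \<comment> \<open>An empty \<open>v i\<close> gives \<open>0\<close> on both sides, as
      \<open>0 powr t = 0\<close> even for \<open>t = 0\<close>. Otherwise the base is at least 1
      and \<open>t \<le> s * r\<close> suffices.\<close>
    also have "\<dots> \<le> Ct * (real (card (v i)) powr s) powr r"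
      using Ct t_le by (cases "card (v i) = 0") (auto simp: powr_powr intro!: mult_left_mono powr_mono)
    finally show "real (card {u \<in> S. u \<subseteq> v i}) \<le> Ct * (real (card (v i)) powr s) powr r" .
  qed
  also have "\<dots> \<le> Ct * (\<Sum>i<n. real (card (v i)) powr s) powr r"
    unfolding sum_distrib_left[symmetric] using Ct
    by (intro mult_left_mono sum_powr_le_powr_sum) (auto simp: r_def)
  also have "\<dots> \<le> Ct * (c / c1) powr r"
    using Ct sum_le by (intro mult_left_mono powr_mono2) (auto simp: r_def intro: sum_nonneg)
  finally show "real (card {u \<in> S. \<exists>i<n. u \<subseteq> v i}) \<le> Ct * (c / c1) powr max 1 (t / s)"
    by (simp add: r_def)
qed

section \<open>Enumerations by decreasing weight and the decay rate\<close>

text \<open>At least half of the first \<open>J\<close> members are uncovered, and each of them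
  weighs at least as much as the \<open>J\<close>-th one.\<close>

lemma nonincr_enum_uncovered:
  assumes enum: "nonincr_enum g S u" and inf: "infinite S" and g: "\<And>x. x \<in> S \<Longrightarrow> 0 \<le> g x"
    and cov: "finite cov" "real (card cov) \<le> real J / 2" and J: "1 \<le> J"
    and sums: "\<And>T. finite T \<Longrightarrow> T \<subseteq> S - cov \<Longrightarrow> (\<Sum>x\<in>T. g x) \<le> e"
  shows "real J / 2 * g (u J) \<le> e"
proof -
  have idx: "idx_set S = {1..}" using inf by (simp add: idx_set_def)
  have bij: "bij_betw u {1..} S" and mono: "\<And>i j. 1 \<le> i \<Longrightarrow> i \<le> j \<Longrightarrow> g (u j) \<le> g (u i)"
    using enum by (auto simp: nonincr_enum_def idx)
  define T where "T = u ` {1..J} - cov"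
  have uS: "u ` {1..J} \<subseteq> S" using bij_betw_imp_surj_on[OF bij] by auto
  have "card (u ` {1..J}) = J"
    by (subst card_image[OF inj_on_subset[OF bij_betw_imp_inj_on[OF bij]]]) auto
  then have "real J - real (card cov) \<le> real (card T)"
    using diff_card_le_card_Diff[OF cov(1), of "u ` {1..J}"] unfolding T_def by linarith
  then have half: "real J / 2 \<le> real (card T)" using cov(2) by linarith
  have "u J \<in> S" using uS J by auto
  then have "real J / 2 * g (u J) \<le> real (card T) * g (u J)"
    using half g by (intro mult_right_mono) auto
  also have "\<dots> = (\<Sum>x\<in>T. g (u J))" by simp
  also have "\<dots> \<le> (\<Sum>x\<in>T. g x)"
    by (rule sum_mono) (auto simp: T_def intro!: mono)
  also have "\<dots> \<le> e" by (rule sums) (use uS in \<open>auto simp: T_def\<close>)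
  finally show ?thesis .
qed

text \<open>Needed because \<open>decay\<close> selects its enumeration with \<open>SOME\<close>. A
  heaviest remaining element is chosen repeatedly. Finite superlevel sets ensure that one exists,
  and that none is left out: an element never chosen would have infinitely many chosen ones above
  it.\<close>

lemma nonincr_enum_exists:
  assumes inf: "infinite S" and fin: "\<And>x. x \<in> S \<Longrightarrow> finite {y \<in> S. g x \<le> g y}"
  shows "\<exists>u. nonincr_enum (g :: 'a \<Rightarrow> real) S u"
proof -
  define best where "best R x \<longleftrightarrow> x \<in> S - R \<and> (\<forall>y\<in>S - R. g y \<le> g x)" for R x
  have ex: "\<exists>x. best R x" if "finite R" for R
  proof -
    have "infinite (S - R)" using inf that by simp
    then obtain z where z: "z \<in> S - R" using infinite_imp_nonempty by blast
    \<comment> \<open>Confines the search for a maximum to a finite set; anything outside it is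
      lighter than \<open>z\<close> or already chosen.\<close>
    define Z where "Z = {y \<in> S. g z \<le> g y} - R"
    have Z: "finite Z" "z \<in> Z" using fin z by (auto simp: Z_def)
    have "Max (g ` Z) \<in> g ` Z" using Z by (intro Max_in) auto
    then obtain x where x: "Max (g ` Z) = g x" "x \<in> Z" by (rule imageE)
    have "g y \<le> g x" if "y \<in> S - R" for y
    proof (cases "g z \<le> g y")
      case True
      then have "y \<in> Z" using that by (auto simp: Z_def)
      then show ?thesis using x(1)[symmetric] Z(1) by simp
    next
      case False
      then show ?thesis using x Z Max_ge[of "g ` Z" "g z"] by fastforce
    qed
    then show ?thesis using x(2) unfolding best_def Z_def by blast
  qed
  define chosen where "chosen = rec_nat {} (\<lambda>_ R. insert (SOME x. best R x) R)"
  define f where "f n = (SOME x. best (chosen n) x)" for n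
  have chosen_simps: "chosen 0 = {}" "chosen (Suc n) = insert (f n) (chosen n)" for n
    by (simp_all add: chosen_def f_def)
  have chosen: "chosen n = f ` {..<n}" for n
    by (induction n) (auto simp: chosen_simps lessThan_Suc)
  have best: "best (f ` {..<n}) (f n)" for n
  proof -
    have "finite (chosen n)" by (simp add: chosen)
    from someI_ex[OF ex[OF this], folded f_def] show ?thesis by (simp only: chosen)
  qed
  have fS: "f n \<in> S" and new: "m < n \<Longrightarrow> f n \<noteq> f m" for m n
    using best[of n] by (auto simp: best_def)
  have mono: "g (f n) \<le> g (f m)" if "m \<le> n" for m n
    using best[of m] best[of n] that by (force simp: best_def)
  have inj: "inj f" using new by (intro injI) (metis linorder_neqE_nat)
  have surj: "x \<in> range f" if x: "x \<in> S" for x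
  proof (rule ccontr)
    assume "x \<notin> range f"
    then have "g x \<le> g (f n)" for n using best[of n] x by (auto simp: best_def)
    then have "range f \<subseteq> {y \<in> S. g x \<le> g y}" using fS by blast
    then have "finite (range f)" using fin[OF x] finite_subset by blast
    then show False using inj range_inj_infinite by blast
  qed
  \<comment> \<open>The greedy choice starts at 0, whereas \<open>idx_set\<close> starts at
    1.\<close>
  have "bij_betw (\<lambda>j. f (j - 1)) {1..} S"
    unfolding bij_betw_def
  proof
    show "inj_on (\<lambda>j. f (j - 1)) {1..}"
      by (intro inj_onI) (auto dest!: injD[OF inj])
    show "(\<lambda>j. f (j - 1)) ` {1..} = S"
    proof
      show "S \<subseteq> (\<lambda>j. f (j - 1)) ` {1..}"
      proof
        fix x assume "x \<in> S"
        then obtain n where "x = f n" using surj by blast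
        then show "x \<in> (\<lambda>j. f (j - 1)) ` {1..}" by (intro image_eqI[of _ _ "Suc n"]) auto
      qed
    qed (use fS in auto)
  qed
  then show ?thesis
    using inf mono by (intro exI[of _ "\<lambda>j. f (j - 1)"]) (simp add: nonincr_enum_def idx_set_def)
qed

lemma finite_superlevel_summable:
  fixes f :: "'a \<Rightarrow> real"
  assumes f: "f summable_on A" "\<And>x. x \<in> A \<Longrightarrow> 0 \<le> f x" and e: "e > 0"
  shows "finite {x \<in> A. e \<le> f x}"
proof (rule ccontr)
  assume "infinite {x \<in> A. e \<le> f x}"
  then obtain T where T: "finite T" "card T = Suc (nat \<lceil>infsum f A / e\<rceil>)" "T \<subseteq> {x \<in> A. e \<le> f x}"
    using infinite_arbitrarily_large by blast
  have "real (card T) * e \<le> (\<Sum>x\<in>T. f x)"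
    using sum_mono[of T "\<lambda>_. e" f] T(3) by auto
  also have "\<dots> \<le> infsum f A"
    using T f by (intro finite_sum_le_infsum) auto
  finally have "real (card T) \<le> infsum f A / e" using e by (simp add: field_simps)
  then show False unfolding T(2) by linarith
qed

lemma decay_finite: "finite (Sset \<gamma> \<sigma>) \<Longrightarrow> decay \<gamma> c \<sigma> = \<infinity>"
proof (rule ereal_top)
  fix p
  assume fin: "finite (Sset \<gamma> \<sigma>)"
  let ?u = "SOME u. nonincr_enum (ghat \<gamma> c) (Sset \<gamma> \<sigma>) u"
  let ?w = "\<lambda>j::nat. if j \<in> idx_set (Sset \<gamma> \<sigma>) then ghat \<gamma> c (?u j) else 0"
  have "\<forall>\<^sub>F j in sequentially. ?w j * real j powr p = 0"
    using eventually_gt_at_top[of "card (Sset \<gamma> \<sigma>)"]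
    by eventually_elim (simp add: idx_set_def fin)
  then have "(\<lambda>j. ?w j * real j powr p) \<longlonglongrightarrow> 0" by (rule tendsto_eventually)
  then show "ereal p \<le> decay \<gamma> c \<sigma>"
    unfolding decay_def Let_def by (intro Sup_upper) blast
qed

text \<open>The bound is assumed for every enumeration since the one chosen by \<open>SOME\<close>
  is unknown. At \<open>p = \<beta>\<close> it gives only boundedness, so the convergence is shown
  for each \<open>p < \<beta>\<close> and the supremum reaches \<open>\<beta>\<close>.\<close>

lemma decay_ge:
  assumes inf: "infinite (Sset \<gamma> \<sigma>)" and c: "0 \<le> c" and \<gamma>: "\<forall>u. 0 \<le> \<gamma> u"
    and ex: "\<exists>u. nonincr_enum (ghat \<gamma> c) (Sset \<gamma> \<sigma>) u"
    and bound: "\<And>u j. nonincr_enum (ghat \<gamma> c) (Sset \<gamma> \<sigma>) u \<Longrightarrow> j \<ge> J0 \<Longrightarrow>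
        ghat \<gamma> c (u j) \<le> K * real j powr (- \<beta>)"
  shows "ereal \<beta> \<le> decay \<gamma> c \<sigma>"
proof (rule dense_le)
  fix y assume y: "y < ereal \<beta>"
  show "y \<le> decay \<gamma> c \<sigma>"
  proof (cases y)
    case (real p)
    then have p: "p < \<beta>" using y by simp
    define u where "u = (SOME u. nonincr_enum (ghat \<gamma> c) (Sset \<gamma> \<sigma>) u)"
    have u: "nonincr_enum (ghat \<gamma> c) (Sset \<gamma> \<sigma>) u" unfolding u_def using ex by (rule someI_ex)
    let ?w = "\<lambda>j::nat. if j \<in> idx_set (Sset \<gamma> \<sigma>) then ghat \<gamma> c (u j) else 0"
    have "(\<lambda>j. ?w j * real j powr p) \<longlonglongrightarrow> 0"
    proof (rule tendsto_sandwich[OF _ _ tendsto_const])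
      show "\<forall>\<^sub>F j in sequentially. 0 \<le> ?w j * real j powr p"
        using c \<gamma> by (simp add: ghat_def)
      show "\<forall>\<^sub>F j in sequentially. ?w j * real j powr p \<le> K * real j powr (- (\<beta> - p))"
        using eventually_ge_at_top[of "max 1 J0"]
      proof eventually_elim
        case (elim j)
        then have "?w j * real j powr p \<le> (K * real j powr (- \<beta>)) * real j powr p"
          using bound[OF u, of j] inf by (intro mult_right_mono) (auto simp: idx_set_def)
        then show ?case by (simp add: mult.assoc powr_add[symmetric])
      qed
      have "(\<lambda>j. real j powr (- (\<beta> - p))) \<longlonglongrightarrow> 0"
        using p by (intro tendsto_neg_powr filterlim_real_sequentially) simp
      then show "(\<lambda>j. K * real j powr (- (\<beta> - p))) \<longlonglongrightarrow> 0" by (rule tendsto_mult_right_zero)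
    qed
    then show ?thesis
      unfolding real decay_def Let_def u_def by (intro Sup_upper) blast
  qed (use y in auto)
qed

section \<open>Growth exponents and the terms of the lower bound\<close>

text \<open>The exponents over which \<open>tstar\<close> takes its infimum. Estimates are proved
  for each of them, because the infimum need not be attained.\<close>

definition growth_exp :: "nat set set \<Rightarrow> real \<Rightarrow> bool" where
  "growth_exp S t \<longleftrightarrow> t \<ge> 0 \<and> (\<exists>C>0. \<forall>v. finite v \<longrightarrow>
     real (card {u \<in> S. u \<subseteq> v}) \<le> C * real (card v) powr t)"

lemma tstar_eq: "tstar \<gamma> \<sigma> = Inf (ereal ` {t. growth_exp (Sset \<gamma> \<sigma>) t})"
  by (simp add: tstar_def growth_exp_def image_def) (rule arg_cong[where f = Inf], blast)

text \<open>Each such \<open>u\<close> is the set of entries of a list of length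
  \<open>\<sigma>\<close> over \<open>v\<close>, obtained by repeating one of its elements, and
  there are \<open>card v ^ \<sigma>\<close> such lists. In particular \<open>tstar\<close> is
  finite.\<close>

lemma growth_exp_Sset: "growth_exp (Sset \<gamma> \<sigma>) (real \<sigma>)"
proof -
  have "real (card {u \<in> Sset \<gamma> \<sigma>. u \<subseteq> v}) \<le> 1 * real (card v) powr real \<sigma>" if v: "finite v" for v
  proof (cases "v = {}")
    case True
    then have *: "{u \<in> Sset \<gamma> \<sigma>. u \<subseteq> v} = {}" by (auto simp: Sset_def)
    show ?thesis unfolding * by simp
  next
    case False
    have "{u \<in> Sset \<gamma> \<sigma>. u \<subseteq> v} \<subseteq> set ` {xs. set xs \<subseteq> v \<and> length xs = \<sigma>}"
    proof
      fix u assume "u \<in> {u \<in> Sset \<gamma> \<sigma>. u \<subseteq> v}"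
      then have u: "finite u" "u \<noteq> {}" "card u \<le> \<sigma>" "u \<subseteq> v" by (auto simp: Sset_def)
      obtain ys where ys: "set ys = u" "distinct ys" using finite_distinct_list[OF u(1)] by blast
      have len: "length ys = card u" using ys distinct_card by fastforce
      have "hd ys \<in> u" using ys(1) u(2) by (metis list.set_sel(1) set_empty)
      then have "set (ys @ replicate (\<sigma> - card u) (hd ys)) = u" using ys(1) by auto
      moreover have "length (ys @ replicate (\<sigma> - card u) (hd ys)) = \<sigma>" using len u(3) by simp
      ultimately show "u \<in> set ` {xs. set xs \<subseteq> v \<and> length xs = \<sigma>}"
        using u(4) by (intro image_eqI[of _ _ "ys @ replicate (\<sigma> - card u) (hd ys)"]) auto
    qed
    then have "card {u \<in> Sset \<gamma> \<sigma>. u \<subseteq> v} \<le> card {xs. set xs \<subseteq> v \<and> length xs = \<sigma>}"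
      using finite_lists_length_eq[OF v] by (intro surj_card_le)
    then have "card {u \<in> Sset \<gamma> \<sigma>. u \<subseteq> v} \<le> card v ^ \<sigma>"
      by (simp add: card_lists_length_eq[OF v])
    then have "real (card {u \<in> Sset \<gamma> \<sigma>. u \<subseteq> v}) \<le> real (card v) ^ \<sigma>"
      by (metis of_nat_le_iff of_nat_power)
    also have "\<dots> = real (card v) powr real \<sigma>"
      using False v by (simp add: powr_realpow card_gt_0_iff)
    finally show ?thesis by simp
  qed
  then show ?thesis unfolding growth_exp_def by (intro conjI exI[of _ 1]) auto
qed

text \<open>Solved for \<open>q\<close>, the assumed bound reads
  \<open>2 \<le> (d - 1) * (q * max 1 (t / s))\<close>. Letting \<open>t\<close> tend to
  \<open>tstar\<close> and then putting \<open>q = p\<close> gives the claim, since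
  \<open>1 / max 1 (\<tau> / s)\<close> is the minimum in \<open>lb_term\<close>.\<close>

lemma lb_term_le:
  assumes s: "0 < s" and p: "0 \<le> p" and decay_gt: "decay \<gamma> c \<sigma> > 1"
    and bound: "\<And>q t. q > 0 \<Longrightarrow> q \<ge> p \<Longrightarrow> growth_exp (Sset \<gamma> \<sigma>) t \<Longrightarrow>
        ereal (1 + 2 / (q * max 1 (t / s))) \<le> decay \<gamma> c \<sigma>"
  shows "lb_term \<gamma> c s \<sigma> \<le> ereal p"
proof (cases "decay \<gamma> c \<sigma>")
  case (real d)
  have d: "d > 1" using decay_gt real by simp
  have main: "2 \<le> (d - 1) * (q * max 1 (t / s))" if "q > 0" "q \<ge> p" "growth_exp (Sset \<gamma> \<sigma>) t" for q t
  proof -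
    have "0 < q * max 1 (t / s)" using that(1) by simp
    moreover have "2 / (q * max 1 (t / s)) \<le> d - 1" using bound[OF that] real by simp
    ultimately show ?thesis by (simp only: pos_divide_le_eq)
  qed
  have t\<^sub>0: "tstar \<gamma> \<sigma> \<le> ereal (real \<sigma>)" "0 \<le> tstar \<gamma> \<sigma>"
    unfolding tstar_eq using growth_exp_Sset
    by (auto intro!: Inf_lower Inf_greatest simp: growth_exp_def)
  then obtain \<tau> where \<tau>: "tstar \<gamma> \<sigma> = ereal \<tau>" "0 \<le> \<tau>" by (cases "tstar \<gamma> \<sigma>") auto
  \<comment> \<open>Every \<open>t > \<tau>\<close> lies above some growth exponent and the
    expression is monotone and continuous in \<open>t\<close>, so a limit from the right yields the
    bound at the infimum.\<close>
  have lim: "2 \<le> (d - 1) * (q * max 1 (\<tau> / s))" if q: "q > 0" "q \<ge> p" for q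
  proof (rule tendsto_le[OF trivial_limit_at_right_real[of \<tau>] _ tendsto_const])
    show "((\<lambda>t. (d - 1) * (q * max 1 (t / s))) \<longlongrightarrow> (d - 1) * (q * max 1 (\<tau> / s))) (at_right \<tau>)"
      using s by (intro tendsto_intros tendsto_max) auto
    show "\<forall>\<^sub>F t in at_right \<tau>. 2 \<le> (d - 1) * (q * max 1 (t / s))"
      using eventually_at_right_less[of \<tau>]
    proof eventually_elim
      case (elim t)
      then have "tstar \<gamma> \<sigma> < ereal t" using \<tau> by simp
      then obtain t' where t': "growth_exp (Sset \<gamma> \<sigma>) t'" "t' < t"
        unfolding tstar_eq Inf_less_iff by auto
      have "(d - 1) * (q * max 1 (t' / s)) \<le> (d - 1) * (q * max 1 (t / s))"
        using d q t'(2) s by (intro mult_left_mono max.mono divide_right_mono) auto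
      then show ?case using main[OF q t'(1)] by linarith
    qed
  qed
  have p_pos: "p > 0"
  proof (rule ccontr)
    assume "\<not> p > 0"
    then have p0: "p = 0" using p by simp
    define m where "m = max 1 (\<tau> / s)"
    have m: "m \<ge> 1" by (simp add: m_def)
    have pos: "(d - 1) * m > 0" using d m by simp
    \<comment> \<open>If \<open>p = 0\<close>, every \<open>q > 0\<close> is admissible; this one
      turns \<open>lim\<close> into \<open>2 \<le> 1\<close>.\<close>
    define q where "q = 1 / ((d - 1) * m)"
    have "q > 0" using pos by (simp add: q_def)
    from lim[OF this] have "2 \<le> q * ((d - 1) * m)" using p0 \<open>q > 0\<close> by (simp add: mult_ac m_def)
    also have "\<dots> = 1" unfolding q_def using d m by simp
    finally show False by simp
  qed
  have key: "2 \<le> (d - 1) * (p * max 1 (\<tau> / s))" using lim[OF p_pos] by simp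
  have min_eq: "min 1 (if tstar \<gamma> \<sigma> = 0 then \<infinity> else ereal s / tstar \<gamma> \<sigma>) = ereal (1 / max 1 (\<tau> / s))"
  proof (cases "\<tau> = 0")
    case False
    then have "\<tau> > 0" using \<tau>(2) by simp
    then have "min 1 (s / \<tau>) = 1 / max 1 (\<tau> / s)"
      using s by (auto simp: min_def max_def field_simps)
    moreover have "min 1 (ereal s / ereal \<tau>) = ereal (min 1 (s / \<tau>))"
      using False by (simp add: one_ereal_def)
    ultimately show ?thesis using False \<tau>(1) by simp
  qed (simp add: \<tau>(1) one_ereal_def zero_ereal_def)
  have "lb_term \<gamma> c s \<sigma> = ereal (2 * (1 / max 1 (\<tau> / s)) / (d - 1))"
    using d unfolding lb_term_def min_eq real
    by (simp add: one_ereal_def numeral_eq_ereal)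
  also have "\<dots> \<le> ereal p"
  proof -
    have "0 < max 1 (\<tau> / s)" by simp
    moreover have "0 < d - 1" using d by simp
    ultimately show ?thesis using key by (simp add: pos_divide_le_eq mult_ac)
  qed
  finally show ?thesis .
next
  case PInf
  then show ?thesis using p by (simp add: lb_term_def)
next
  case MInf
  then show ?thesis using decay_gt by simp
qed

lemma ennreal_less_add_one: "0 \<le> x \<Longrightarrow> y \<le> ennreal x \<Longrightarrow> y < ennreal (x + 1)"
  by (erule le_less_trans) (simp add: ennreal_less_iff)

section \<open>Consequences of a polynomial complexity bound\<close>

context weighted_kernel
begin

lemma ghat_nonneg: "0 \<le> ghat \<gamma> (C0 k \<rho>) u"
  using gamma_nonneg C0_pos by (simp add: ghat_def)

lemma ghat_summable: "ghat \<gamma> (C0 k \<rho>) summable_on {u. finite u}"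
proof (rule summable_on_comparison_test[OF gamma_summable])
  show "ghat \<gamma> (C0 k \<rho>) u \<le> \<gamma> u * Mk k \<rho> ^ card u" for u
    unfolding ghat_def using gamma_nonneg C0_pos C0_le_Mk by (intro mult_left_mono power_mono) auto
qed (rule ghat_nonneg)

lemma ghat_enum_exists:
  assumes "infinite (Sset \<gamma> \<sigma>)"
  shows "\<exists>u. nonincr_enum (ghat \<gamma> (C0 k \<rho>)) (Sset \<gamma> \<sigma>) u"
proof (rule nonincr_enum_exists[OF assms])
  fix u assume "u \<in> Sset \<gamma> \<sigma>"
  then have "ghat \<gamma> (C0 k \<rho>) u > 0" using C0_pos by (simp add: ghat_def Sset_def)
  from finite_superlevel_summable[OF ghat_summable ghat_nonneg this]
  show "finite {v \<in> Sset \<gamma> \<sigma>. ghat \<gamma> (C0 k \<rho>) u \<le> ghat \<gamma> (C0 k \<rho>) v}"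
    by (rule finite_subset[rotated]) (auto simp: Sset_def)
qed

text \<open>With \<open>\<epsilon>\<close> chosen so that at most half of the \<open>J\<close> largest weights can be covered by the
  sets \<open>v i\<close>, the uncovered ones contribute at least \<open>J / 2\<close> times the \<open>J\<close>-th weight to the
  squared error.\<close>

lemma decay_lower_bound:
  assumes cst: "\<forall>\<nu>. 1 \<le> cst \<nu>" and s: "0 < s"
    and growth: "\<exists>c>0. eventually (\<lambda>\<nu>. ennreal (c * real \<nu> powr s) \<le> cst \<nu>) sequentially"
    and C: "0 \<le> C" and p: "0 \<le> p"
    and comp: "\<forall>\<epsilon>>0. comp_res TYPE('w) cst D a F B (Iint \<rho>) \<epsilon> \<le> ennreal (C * \<epsilon> powr (- p))"
    and q: "q > 0" "q \<ge> p" and t: "growth_exp (Sset \<gamma> \<sigma>) t"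
  shows "ereal (1 + 2 / (q * max 1 (t / s))) \<le> decay \<gamma> (C0 k \<rho>) \<sigma>"
proof (cases "finite (Sset \<gamma> \<sigma>)")
  case True
  then show ?thesis by (simp add: decay_finite)
next
  case False
  define r where "r = max 1 (t / s)"
  have r: "r \<ge> 1" by (simp add: r_def)
  \<comment> \<open>A budget of order \<open>\<epsilon> powr (- q)\<close> covers a number of sets
    of order \<open>\<epsilon> powr (- \<theta>)\<close>.\<close>
  define \<theta> where "\<theta> = q * r"
  have \<theta>: "\<theta> > 0" using q r by (simp add: \<theta>_def)
  obtain c1 where c1: "c1 > 0" "\<forall>\<nu>. ennreal (c1 * real \<nu> powr s) \<le> cst \<nu>"
    by (rule cost_power_bound[OF cst s growth])
  obtain Ct where Ct: "Ct > 0" "\<forall>v. finite v \<longrightarrow> real (card {u \<in> Sset \<gamma> \<sigma>. u \<subseteq> v}) \<le> Ct * real (card v) powr t"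
    using t unfolding growth_exp_def by blast
  define E where "E = Ct * ((C + 1) / c1) powr r"
  have E: "E > 0" using Ct c1 C by (simp add: E_def)
  have weight: "ghat \<gamma> (C0 k \<rho>) (u J) \<le> 2 * (2 * E) powr (2 / \<theta>) * real J powr (- (1 + 2 / \<theta>))"
    if u: "nonincr_enum (ghat \<gamma> (C0 k \<rho>)) (Sset \<gamma> \<sigma>) u" and J: "J \<ge> max 1 (nat \<lceil>2 * E\<rceil>)" for u J
  proof -
    have J1: "1 \<le> J" and JE: "2 * E \<le> real J" using J by linarith+
    \<comment> \<open>Solves \<open>E * \<epsilon> powr (- \<theta>) = J / 2\<close>, the left side
      being the bound on the number of covered sets. The condition \<open>J \<ge> 2 * E\<close>
      makes \<open>\<epsilon> \<le> 1\<close>.\<close>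
    define \<epsilon> where "\<epsilon> = (2 * E / real J) powr (1 / \<theta>)"
    have base: "0 < 2 * E / real J" using E J1 by simp
    have \<epsilon>: "0 < \<epsilon>" unfolding \<epsilon>_def powr_gt_zero using base by (rule less_imp_neq[symmetric])
    have \<epsilon>1: "\<epsilon> \<le> 1"
      unfolding \<epsilon>_def using E JE J1 \<theta> by (intro powr_le1) auto
    have "comp_res TYPE('w) cst D a F B (Iint \<rho>) \<epsilon> < ennreal (C * \<epsilon> powr (- p) + 1)"
      using comp \<epsilon> C by (intro ennreal_less_add_one) auto
    then obtain n and v :: "nat \<Rightarrow> nat set" where v: "\<forall>i<n. finite (v i)"
      "(\<Sum>i<n. cst (card (v i))) < ennreal (C * \<epsilon> powr (- p) + 1)"
      "\<forall>T. finite T \<and> (\<forall>u\<in>T. finite u \<and> (\<forall>i<n. \<not> u \<subseteq> v i)) \<longrightarrow> (\<Sum>u\<in>T. ghat \<gamma> (C0 k \<rho>) u) \<le> \<epsilon>\<^sup>2"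
      by (rule comp_res_ghat_sum)
    define cov where "cov = {u \<in> Sset \<gamma> \<sigma>. \<exists>i<n. u \<subseteq> v i}"
    note covered = card_covered_le[OF Ct(2,1) s c1 v(1,2), folded cov_def r_def]
    \<comment> \<open>For \<open>\<epsilon> \<le> 1\<close> the summand 1, added to make the bound
      strict, and the passage from \<open>p\<close> to \<open>q\<close> are both absorbed.\<close>
    have "C * \<epsilon> powr (- p) + 1 \<le> (C + 1) * \<epsilon> powr (- q)"
    proof -
      have mono: "\<epsilon> powr (- p) \<le> \<epsilon> powr (- q)" "1 \<le> \<epsilon> powr (- q)"
        using powr_mono'[of "- q" "- p" \<epsilon>] powr_mono'[of "- q" 0 \<epsilon>] \<epsilon> \<epsilon>1 q by auto
      show ?thesis using mult_left_mono[OF mono(1) C] mono(2) by (simp add: distrib_right)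
    qed
    then have "(C * \<epsilon> powr (- p) + 1) / c1 \<le> ((C + 1) / c1) * \<epsilon> powr (- q)"
      using c1 by (simp add: divide_right_mono)
    then have "Ct * ((C * \<epsilon> powr (- p) + 1) / c1) powr r \<le> Ct * (((C + 1) / c1) * \<epsilon> powr (- q)) powr r"
      using C c1 Ct r by (intro mult_left_mono powr_mono2) auto
    also have "\<dots> = E * \<epsilon> powr (- \<theta>)"
      using C c1 by (subst powr_mult) (auto simp: E_def \<theta>_def powr_powr)
    also have "\<epsilon> powr (- \<theta>) = real J / (2 * E)"
      unfolding \<epsilon>_def using \<theta> E by (simp add: powr_powr powr_minus_divide)
    also have "E * (real J / (2 * E)) = real J / 2" using E by simp
    finally have half: "real (card cov) \<le> real J / 2" using covered(2) by linarith
    have "real J / 2 * ghat \<gamma> (C0 k \<rho>) (u J) \<le> \<epsilon>\<^sup>2"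
    proof (rule nonincr_enum_uncovered[OF u False ghat_nonneg covered(1) half J1])
      fix T assume "finite T" "T \<subseteq> Sset \<gamma> \<sigma> - cov"
      then show "(\<Sum>x\<in>T. ghat \<gamma> (C0 k \<rho>) x) \<le> \<epsilon>\<^sup>2"
        by (intro v(3)[rule_format]) (auto simp: cov_def Sset_def)
    qed
    also have "\<epsilon>\<^sup>2 = \<epsilon> powr 2" using \<epsilon> by simp
    also have "\<dots> = (2 * E / real J) powr (2 / \<theta>)" by (simp add: \<epsilon>_def powr_powr)
    also have "\<dots> = (2 * E) powr (2 / \<theta>) * real J powr (- (2 / \<theta>))"
      using E by (simp add: powr_divide powr_minus_divide)
    finally have "ghat \<gamma> (C0 k \<rho>) (u J) \<le> 2 * ((2 * E) powr (2 / \<theta>) * real J powr (- (2 / \<theta>))) / real J"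
      using J1 by (simp add: field_simps)
    also have "\<dots> = 2 * (2 * E) powr (2 / \<theta>) * (real J powr (- (2 / \<theta>)) * real J powr (- 1))"
      using J1 by (simp add: powr_minus_divide)
    also have "real J powr (- (2 / \<theta>)) * real J powr (- 1) = real J powr (- (1 + 2 / \<theta>))"
      unfolding powr_add[symmetric] by (rule arg_cong[where f = "\<lambda>x. real J powr x"]) simp
    finally show ?thesis .
  qed
  have "ereal (1 + 2 / \<theta>) \<le> decay \<gamma> (C0 k \<rho>) \<sigma>"
    by (rule decay_ge[where K = "2 * (2 * E) powr (2 / \<theta>)" and \<beta> = "1 + 2 / \<theta>",
          OF False less_imp_le[OF C0_pos] gamma_nonneg ghat_enum_exists[OF False]])
      (rule weight)
  then show ?thesis by (simp add: \<theta>_def r_def)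
qed

text \<open>About \<open>\<epsilon> powr (- p)\<close> univariate evaluations reach squared error
  \<open>\<epsilon>^2\<close>, but the lower bound for that many is of order
  \<open>\<epsilon> powr (p * \<alpha>)\<close>. For \<open>p * \<alpha> < 2\<close> these conflict
  as \<open>\<epsilon>\<close> tends to 0.\<close>

lemma univariate_lower_bound:
  assumes cst: "\<forall>\<nu>. 1 \<le> cst \<nu>" and mono: "mono cst" and \<alpha>: "0 < \<alpha>"
    and lower: "\<exists>c>0. eventually (\<lambda>N. ennreal (c * real N powr (-\<alpha>))
        \<le> emin1_sq TYPE('w) cst D F1 (unit_ball F1 ip1) (\<lambda>g. \<integral>x. g x \<partial>\<rho>) N) sequentially"
    and C: "0 \<le> C" and p: "0 \<le> p"
    and comp: "\<forall>\<epsilon>>0. comp_res TYPE('w) cst D a F B (Iint \<rho>) \<epsilon> \<le> ennreal (C * \<epsilon> powr (- p))"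
  shows "2 / \<alpha> \<le> p"
proof (rule ccontr)
  assume "\<not> 2 / \<alpha> \<le> p"
  then have gap: "0 < 2 - p * \<alpha>" using \<alpha> by (simp add: field_simps)
  have comp_less: "comp_res TYPE('w) cst D a F B (Iint \<rho>) \<epsilon> < ennreal (C * \<epsilon> powr (- p) + 1)"
    if "\<epsilon> > 0" for \<epsilon>
    using comp that C by (intro ennreal_less_add_one) auto
  show False
  proof (cases "cst 1")
    \<comment> \<open>With infinite price for one active coordinate, monotonicity leaves only empty
      \<open>v i\<close> within a finite budget. Then \<open>{1}\<close> is uncovered and the
      squared error is at least \<open>g\<close>, more than the chosen
      \<open>\<epsilon>^2 = g / 2\<close>.\<close>
    case top
    define g where "g = ghat \<gamma> (C0 k \<rho>) {1}"
    have g: "g > 0" using gamma1 C0_pos by (simp add: g_def ghat_def)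
    define \<epsilon> where "\<epsilon> = sqrt (g / 2)"
    have \<epsilon>: "\<epsilon> > 0" "\<epsilon>\<^sup>2 < g" using g by (simp_all add: \<epsilon>_def)
    obtain n and v :: "nat \<Rightarrow> nat set" where v: "\<forall>i<n. finite (v i)"
      "(\<Sum>i<n. cst (card (v i))) < ennreal (C * \<epsilon> powr (- p) + 1)"
      "\<forall>T. finite T \<and> (\<forall>u\<in>T. finite u \<and> (\<forall>i<n. \<not> u \<subseteq> v i)) \<longrightarrow> (\<Sum>u\<in>T. ghat \<gamma> (C0 k \<rho>) u) \<le> \<epsilon>\<^sup>2"
      by (rule comp_res_ghat_sum[OF comp_less[OF \<epsilon>(1)]])
    have "v i = {}" if i: "i < n" for i
    proof (rule ccontr)
      assume "v i \<noteq> {}"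
      then have "1 \<le> card (v i)" using v(1) i by (simp add: Suc_le_eq card_gt_0_iff One_nat_def)
      then have "cst (card (v i)) = top" using monoD[OF mono, of 1 "card (v i)"] top
        by (simp add: top_unique)
      then have "top \<le> (\<Sum>i<n. cst (card (v i)))"
        using member_le_sum[of i "{..<n}" "\<lambda>i. cst (card (v i))"] i by simp
      from le_less_trans[OF this v(2)] show False by simp
    qed
    then have "(\<Sum>u\<in>{{1}}. ghat \<gamma> (C0 k \<rho>) u) \<le> \<epsilon>\<^sup>2"
      by (intro v(3)[rule_format]) auto
    then show False using \<epsilon>(2) by (simp add: g_def)
  next
    case (real \<kappa>)
    obtain c0 N0 where c0: "c0 > 0" and N0: "\<And>N. N \<ge> N0 \<Longrightarrow> ennreal (c0 * real N powr (-\<alpha>))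
        \<le> emin1_sq TYPE('w) cst D F1 (unit_ball F1 ip1) (\<lambda>g. \<integral>x. g x \<partial>\<rho>) N"
      using lower unfolding eventually_sequentially by blast
    \<comment> \<open>Chosen so that \<open>N \<le> E * \<epsilon> powr (- p)\<close> below:
      \<open>N0\<close> puts \<open>N\<close> past the threshold of the lower bound, and 2 pays for
      rounding up and for keeping \<open>N\<close> positive.\<close>
    define E where "E = \<kappa> * (C + 1) + real N0 + 2"
    have E: "E > 0" using real(1) C by (simp add: E_def add_nonneg_pos)
    have bound: "c0 * E powr (- \<alpha>) \<le> \<epsilon> powr (2 - p * \<alpha>)" if \<epsilon>: "0 < \<epsilon>" "\<epsilon> \<le> 1" for \<epsilon>
    proof -
      define c where "c = C * \<epsilon> powr (- p) + 1"
      define N where "N = nat \<lceil>\<kappa> * c\<rceil> + N0 + 1"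
      have "1 \<le> \<epsilon> powr (- p)"
        using powr_mono'[of "- p" 0 \<epsilon>] \<epsilon> p by auto
      then have c_le: "c \<le> (C + 1) * \<epsilon> powr (- p)"
        and N0_le: "(real N0 + 2) * 1 \<le> (real N0 + 2) * \<epsilon> powr (- p)"
        by (simp add: c_def distrib_right, intro mult_left_mono) simp_all
      have "0 \<le> \<kappa> * c" using real(1) C by (simp add: c_def)
      then have "real N \<le> \<kappa> * c + real N0 + 2" and N_ge: "\<kappa> * c \<le> real N" unfolding N_def by linarith+
      moreover have "\<kappa> * c \<le> \<kappa> * ((C + 1) * \<epsilon> powr (- p))" using c_le real(1) by (rule mult_left_mono)
      ultimately have N_le: "real N \<le> E * \<epsilon> powr (- p)"
        using N0_le unfolding E_def by (simp add: distrib_right mult.assoc)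
      have "ennreal (c0 * real N powr (-\<alpha>)) \<le> ennreal (\<epsilon>\<^sup>2)"
        using N0 emin1_sq_le[OF comp_less[OF \<epsilon>(1), folded c_def] cst real(2,1) N_ge]
        by (rule order_trans) (simp add: N_def)
      then have N_error: "c0 * real N powr (-\<alpha>) \<le> \<epsilon>\<^sup>2" by (simp add: ennreal_le_iff)
      have "(E * \<epsilon> powr (- p)) powr (-\<alpha>) \<le> real N powr (-\<alpha>)"
        using N_le \<alpha> by (intro powr_mono2') (auto simp: N_def)
      moreover have "(E * \<epsilon> powr (- p)) powr (-\<alpha>) = E powr (-\<alpha>) * \<epsilon> powr (p * \<alpha>)"
        using E \<epsilon> by (simp add: powr_mult powr_powr)
      ultimately have "c0 * (E powr (-\<alpha>) * \<epsilon> powr (p * \<alpha>)) \<le> c0 * real N powr (-\<alpha>)"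
        using c0 by (intro mult_left_mono) auto
      also note N_error
      also have "\<epsilon>\<^sup>2 = \<epsilon> powr 2" using \<epsilon> by simp
      finally have "c0 * (E powr (-\<alpha>) * \<epsilon> powr (p * \<alpha>)) \<le> \<epsilon> powr 2" .
      then have "c0 * E powr (-\<alpha>) \<le> \<epsilon> powr 2 / \<epsilon> powr (p * \<alpha>)"
        using \<epsilon> by (simp add: pos_le_divide_eq mult.assoc)
      then show ?thesis by (simp add: powr_diff)
    qed
    define K where "K = c0 * E powr (- \<alpha>)"
    have K: "K > 0" using c0 E by (simp add: K_def)
    \<comment> \<open>Makes \<open>\<epsilon> powr (2 - p * \<alpha>) \<le> K / 2\<close>, against
      \<open>bound\<close>, which demands at least \<open>K\<close>.\<close>
    define \<epsilon> where "\<epsilon> = min 1 ((K / 2) powr (1 / (2 - p * \<alpha>)))"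
    have \<epsilon>: "0 < \<epsilon>" "\<epsilon> \<le> 1" using K by (simp_all add: \<epsilon>_def)
    have "\<epsilon> powr (2 - p * \<alpha>) \<le> ((K / 2) powr (1 / (2 - p * \<alpha>))) powr (2 - p * \<alpha>)"
      using gap \<epsilon> by (intro powr_mono2) (auto simp: \<epsilon>_def)
    also have "\<dots> = K / 2" using gap K by (simp add: powr_powr)
    finally show False using bound[OF \<epsilon>] K by (simp add: K_def)
  qed
qed

end

theorem theorem3p1:
  fixes D :: "real set" and a :: real and k :: "real \<Rightarrow> real \<Rightarrow> real"
    and \<rho> :: "real measure" and \<gamma> :: "nat set \<Rightarrow> real"
    and cst :: "nat \<Rightarrow> ennreal" and s \<alpha> :: real
    and F :: "((nat \<Rightarrow> real) \<Rightarrow> real) set"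
    and ip :: "((nat \<Rightarrow> real) \<Rightarrow> real) \<Rightarrow> ((nat \<Rightarrow> real) \<Rightarrow> real) \<Rightarrow> real"
    and F1 :: "(real \<Rightarrow> real) set"
    and ip1 :: "(real \<Rightarrow> real) \<Rightarrow> (real \<Rightarrow> real) \<Rightarrow> real"
  assumes D_borel: "D \<in> sets borel" and a_in: "a \<in> D"
    and k_kernel: "psd_kernel k D"
    and k_nonzero: "\<exists>x\<in>D. \<exists>y\<in>D. k x y \<noteq> 0"
    and k_anchor: "k a a = 0"
    and rho_prob: "prob_space \<rho>"
    and rho_sets: "sets \<rho> = sets (restrict_space borel D)"
    and k_meas: "(\<lambda>(x, y). k x y) \<in> borel_measurable (\<rho> \<Otimes>\<^sub>M \<rho>)"
    and M_finite: "integrable \<rho> (\<lambda>x. k x x)"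
    and gamma_nonneg: "\<forall>u. 0 \<le> \<gamma> u"
    and gamma_summable: "(\<lambda>u. \<gamma> u * Mk k \<rho> ^ card u) summable_on {u. finite u}"
    and C0_pos: "C0 k \<rho> > 0"
    and H_rkhs: "is_rkhs (Kgam k \<gamma>) (Xdom k \<gamma> D) F ip"
    and cost_mono: "mono cst"
    and cost_ge1: "\<forall>\<nu>. 1 \<le> cst \<nu>"
    and s_pos: "0 < s"
    and cost_growth: "\<exists>c>0. eventually (\<lambda>\<nu>. ennreal (c * real \<nu> powr s) \<le> cst \<nu>) sequentially"
    and gamma1: "\<gamma> {1} > 0"
    and H1_rkhs: "is_rkhs (\<lambda>x y. \<gamma> {1} * k x y) D F1 ip1"
    and alpha_pos: "0 < \<alpha>"
    and univ_lower: "\<exists>c>0. eventually (\<lambda>N. ennreal (c * real N powr (-\<alpha>))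
        \<le> emin1_sq TYPE('w) cst D F1 (unit_ball F1 ip1) (\<lambda>g. \<integral>x. g x \<partial>\<rho>) N) sequentially"
  shows "(strong_poly_tractable
            (comp_res TYPE('w) cst D a F (unit_ball F ip) (Iint \<rho>))
          \<longrightarrow> (\<forall>\<sigma>\<ge>1. decay \<gamma> (C0 k \<rho>) \<sigma> > 1))
      \<and> ((\<forall>\<sigma>\<ge>1. decay \<gamma> (C0 k \<rho>) \<sigma> > 1)
          \<longrightarrow> tract_exp (comp_res TYPE('w) cst D a F (unit_ball F ip) (Iint \<rho>))
              \<ge> max (ereal (2 / \<alpha>)) (SUP \<sigma>\<in>{1..}. lb_term \<gamma> (C0 k \<rho>) s \<sigma>))"
proof -
  interpret weighted_kernel D a k \<rho> \<gamma> F ip F1 ip1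
    by (rule weighted_kernel.intro) (fact a_in k_kernel k_anchor rho_prob rho_sets k_meas M_finite gamma_nonneg
        gamma_summable C0_pos H_rkhs gamma1 H1_rkhs)+
  let ?comp = "comp_res TYPE('w) cst D a F (unit_ball F ip) (Iint \<rho>)"
  note decay_bound = decay_lower_bound[OF cost_ge1 s_pos cost_growth]
  have "decay \<gamma> (C0 k \<rho>) \<sigma> > 1" if tractable: "strong_poly_tractable ?comp" for \<sigma>
  proof -
    obtain C p where p: "C \<ge> 0" "p \<ge> 0" "\<forall>\<epsilon>>0. ?comp \<epsilon> \<le> ennreal (C * \<epsilon> powr (- p))"
      using tractable unfolding strong_poly_tractable_def by blast
    \<comment> \<open>\<open>p + 1\<close> serves as a positive \<open>q \<ge> p\<close>, and the
      growth exponent \<open>\<sigma>\<close> is always available.\<close>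
    have "ereal 1 < ereal (1 + 2 / ((p + 1) * max 1 (real \<sigma> / s)))"
      using p(2) by simp
    also have "\<dots> \<le> decay \<gamma> (C0 k \<rho>) \<sigma>"
      using p(2) by (intro decay_bound[OF p] growth_exp_Sset) auto
    finally show ?thesis by (simp add: one_ereal_def)
  qed
  moreover have "max (ereal (2 / \<alpha>)) (SUP \<sigma>\<in>{1..}. lb_term \<gamma> (C0 k \<rho>) s \<sigma>) \<le> tract_exp ?comp"
    if decay: "\<forall>\<sigma>\<ge>1. decay \<gamma> (C0 k \<rho>) \<sigma> > 1"
    unfolding tract_exp_def
  proof (rule Inf_greatest)
    fix e assume "e \<in> {ereal p | p. p \<ge> 0 \<and> (\<exists>C\<ge>0. \<forall>\<epsilon>>0. ?comp \<epsilon> \<le> ennreal (C * \<epsilon> powr (- p)))}"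
    then obtain p C where e: "e = ereal p" and
      p: "C \<ge> 0" "p \<ge> 0" "\<forall>\<epsilon>>0. ?comp \<epsilon> \<le> ennreal (C * \<epsilon> powr (- p))"
      by blast
    have "2 / \<alpha> \<le> p"
      by (rule univariate_lower_bound[OF cost_ge1 cost_mono alpha_pos univ_lower p])
    moreover have "lb_term \<gamma> (C0 k \<rho>) s \<sigma> \<le> ereal p" if "\<sigma> \<ge> 1" for \<sigma>
      by (rule lb_term_le[OF s_pos p(2) decay[rule_format, OF that] decay_bound[OF p]])
    ultimately show "max (ereal (2 / \<alpha>)) (SUP \<sigma>\<in>{1..}. lb_term \<gamma> (C0 k \<rho>) s \<sigma>) \<le> e"
      unfolding e by (auto intro!: SUP_least)
  qed
  ultimately show ?thesis by blast
qed

end
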